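(* Let $\mathcal P$ and $\mathcal Q$ be ridge-scribed $d$-polytopes, each having a facet Möbius equivalent to $F$. Then the connected sum $\mathcal P\#_F\mathcal Q$ (where the two facets are identified via Möbius equivalences) is ridge-scribable.
   Context: Let $\mathbb S^d=\{x\in\mathbb R^{d+1}:\|x\|_2=1\}$, with coordinates $x_0,\dots,x_d$. A spherical polytope is an intersection of finitely many closed hemispheres of $\mathbb S^d$ containing no two antipodal points; equivalently, $\mathcal P=\mathcal K\cap\mathbb S^d$ for a pointed polyhedral cone $\mathcal K\subset\mathbb R^{d+1}$. Its $k$-faces are the intersections with $\mathbb S^d$ of the $(k+1)$-dimensional faces of $\mathcal K$; ridges are the $(d-2)$-faces and facets the $(d-1)$-faces of a $d$-polytope. A realization of a combinatorial type of $d$-polytope is a spherical $d$-polytope in $\mathbb S^d$ with isomorphic face lattice. Let $\mathcal B=\{x\in\mathbb S^d: x_0\ge 0,\ -x_0^2+x_1^2+\dots+x_d^2\le 0\}$ and $\mathcal S=\partial\mathcal B$. For a face $G$, $\operatorname{Span}(G)$ is the intersection of the linear span of $G$ with $\mathbb S^d$. A face $G$ is tangent to $\mathcal S$ if $\operatorname{relint}(G)\cap\mathcal S$ consists of a single point and $\operatorname{Span}(G)$ does not meet the interior of $\mathcal B$. A $d$-polytope is ridge-scribed if all its $(d-2)$-faces are tangent to $\mathcal S$, and a combinatorial type is ridge-scribable if it has a ridge-scribed realization. A Möbius transformation is a projective transformation preserving $\mathcal S$ (i.e. induced by a linear automorphism of $\mathbb R^{d+1}$ preserving the cone $\{-x_0^2+x_1^2+\dots+x_d^2\le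 0,\ x_0\ge 0\}$). Two polytopes are Möbius equivalent (resp. projectively equivalent) if a Möbius (resp. projective) transformation maps one onto the other. If $\mathcal P$ and $\mathcal Q$ are $d$-polytopes each with a facet projectively equivalent to $F$, their connected sum $\mathcal P\#_F\mathcal Q$ is the polytope obtained by gluing $\mathcal P$ and $\mathcal Q$ by identifying these facets; combinatorially, its boundary complex is obtained from the boundary complexes of $\mathcal P$ and $\mathcal Q$ by deleting the two facets and identifying their boundaries via the given equivalence. *)

theory Defs
  imports "HOL-Analysis.Analysis"
begin

text \<open>The ambient space is \<open>\<real>\<^sup>d\<^sup>+\<^sup>1 = \<real> \<times> \<real>\<^sup>d\<close> with \<open>d = CARD('d)\<close>: the coordinate \<open>x\<^sub>0\<close> is
  \<^term>\<open>fst x\<close>, and \<open>(x\<^sub>1, \<dots>, x\<^sub>d)\<close> is \<^term>\<open>snd x\<close>. The norm of the product type is the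
  Euclidean norm, so \<open>\<S>\<^sup>d\<close> is \<open>sphere 0 1\<close>.\<close>

type_synonym 'd space = "real \<times> (real ^ 'd)"


section \<open>Spherical polytopes\<close>

definition spherical_polytope :: "'d::finite space set \<Rightarrow> bool" where
  "spherical_polytope P \<longleftrightarrow>
     (\<exists>N. finite N \<and> 0 \<notin> N \<and> P = {x \<in> sphere 0 1. \<forall>a\<in>N. 0 \<le> a \<bullet> x}) \<and>
     (\<forall>x\<in>P. - x \<notin> P)"

text \<open>The cone \<open>K\<close> with \<open>P = K \<inter> \<S>\<^sup>d\<close> is \<^term>\<open>convex_cone hull P\<close>, where
  \<open>convex_cone hull {} = {0}\<close>. Dimensions are integers: the empty polytope, which is the
  empty face of every polytope, has dimension -1.\<close>

definition spherical_dim :: "'d::finite space set \<Rightarrow> int" where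
  "spherical_dim P = aff_dim (convex_cone hull P) - 1"

definition spherical_faces :: "'d::finite space set \<Rightarrow> 'd space set set" where
  "spherical_faces P = {C \<inter> sphere 0 1 |C. C face_of (convex_cone hull P)}"

definition spherical_k_faces :: "int \<Rightarrow> 'd::finite space set \<Rightarrow> 'd space set set" where
  "spherical_k_faces k P =
     {C \<inter> sphere 0 1 |C. C face_of (convex_cone hull P) \<and> aff_dim C = k + 1}"

definition spherical_span :: "'d::finite space set \<Rightarrow> 'd space set" where
  "spherical_span G = span G \<inter> sphere 0 1"

definition spherical_relint :: "'d::finite space set \<Rightarrow> 'd space set" where
  "spherical_relint G = rel_interior (convex_cone hull G) \<inter> sphere 0 1"

definition d_polytope :: "'d::finite space set \<Rightarrow> bool" where
  "d_polytope P \<longleftrightarrow> spherical_polytope P \<and> spherical_dim P = int CARD('d)"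

definition facets :: "'d::finite space set \<Rightarrow> 'd space set set" where
  "facets P = spherical_k_faces (int CARD('d) - 1) P"

definition ridges :: "'d::finite space set \<Rightarrow> 'd space set set" where
  "ridges P = spherical_k_faces (int CARD('d) - 2) P"


section \<open>Ridge-scribed polytopes and Moebius transformations\<close>

definition lorentz_cone :: "'d::finite space set" where
  "lorentz_cone = {x. 0 \<le> fst x \<and> - (fst x)\<^sup>2 + (\<Sum>i\<in>UNIV. (snd x $ i)\<^sup>2) \<le> 0}"

definition scribing_ball :: "'d::finite space set" where
  "scribing_ball = lorentz_cone \<inter> sphere 0 1"

text \<open>Interior and boundary of the ball are taken in the topology of \<open>\<S>\<^sup>d\<close>.\<close>

definition scribing_sphere :: "'d::finite space set" where
  "scribing_sphere = (top_of_set (sphere 0 1)) frontier_of scribing_ball"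

definition tangent_face :: "'d::finite space set \<Rightarrow> bool" where
  "tangent_face G \<longleftrightarrow>
     is_singleton (spherical_relint G \<inter> scribing_sphere) \<and>
     spherical_span G \<inter> ((top_of_set (sphere 0 1)) interior_of scribing_ball) = {}"

definition ridge_scribed :: "'d::finite space set \<Rightarrow> bool" where
  "ridge_scribed P \<longleftrightarrow> d_polytope P \<and> (\<forall>G\<in>ridges P. tangent_face G)"

text \<open>A linear automorphism \<open>L\<close> acts on \<open>\<S>\<^sup>d\<close> by \<open>x \<mapsto> L x / \<parallel>L x\<parallel> = sgn (L x)\<close>.\<close>

definition moebius_map :: "('d::finite space \<Rightarrow> 'd space) \<Rightarrow> bool" where
  "moebius_map f \<longleftrightarrow>
     (\<exists>L. linear L \<and> bij L \<and> L ` lorentz_cone = lorentz_cone \<and>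
          (\<forall>x\<in>sphere 0 1. f x = sgn (L x)))"


section \<open>Combinatorial types\<close>

text \<open>A poset is represented by its reflexive order relation, whose \<^term>\<open>Field\<close> is the
  carrier.\<close>

definition order_isomorphic :: "'a rel \<Rightarrow> 'b rel \<Rightarrow> bool" where
  "order_isomorphic r s \<longleftrightarrow>
     (\<exists>h. bij_betw h (Field r) (Field s) \<and>
          (\<forall>x\<in>Field r. \<forall>y\<in>Field r. (x, y) \<in> r \<longleftrightarrow> (h x, h y) \<in> s))"

definition face_lattice :: "'d::finite space set \<Rightarrow> 'd space set rel" where
  "face_lattice P = {(A, B). A \<in> spherical_faces P \<and> B \<in> spherical_faces P \<and> A \<subseteq> B}"

definition realization :: "'c rel \<Rightarrow> 'd::finite space set \<Rightarrow> bool" where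
  "realization L R \<longleftrightarrow> d_polytope R \<and> order_isomorphic (face_lattice R) L"

definition ridge_scribable :: "'d::finite itself \<Rightarrow> 'c rel \<Rightarrow> bool" where
  "ridge_scribable (_ :: 'd itself) L \<longleftrightarrow>
     (\<exists>R :: 'd space set. realization L R \<and> ridge_scribed R)"


section \<open>Connected sums\<close>

definition boundary_complex :: "'d::finite space set \<Rightarrow> 'd space set set" where
  "boundary_complex P = spherical_faces P - {P}"

text \<open>The facets \<open>f ` F\<close> of \<open>P\<close> and \<open>g ` F\<close> of \<open>Q\<close> are deleted, and their boundary complexes
  are identified by matching \<open>f ` A\<close> with \<open>g ` A\<close> for every proper face \<open>A\<close> of \<open>F\<close>. Faces of
  \<open>P\<close> and \<open>Q\<close> are tagged by \<^term>\<open>Inl\<close> and \<^term>\<open>Inr\<close>, so the relative position of \<open>P\<close> and \<open>Q\<close> in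
  \<open>\<S>\<^sup>d\<close> is irrelevant.\<close>

definition sum_cells ::
  "'d::finite space set \<Rightarrow> 'd space set \<Rightarrow> 'd space set \<Rightarrow>
   ('d space \<Rightarrow> 'd space) \<Rightarrow> ('d space \<Rightarrow> 'd space) \<Rightarrow> ('d space set + 'd space set) set" where
  "sum_cells P Q F f g =
     Inl ` (boundary_complex P - {f ` F}) \<union> Inr ` (boundary_complex Q - {g ` F})"

definition sum_identification ::
  "'d::finite space set \<Rightarrow> ('d space \<Rightarrow> 'd space) \<Rightarrow> ('d space \<Rightarrow> 'd space) \<Rightarrow>
   ('d space set + 'd space set) rel" where
  "sum_identification F f g =
     {(x, y). equivclp (\<lambda>x y. \<exists>A\<in>boundary_complex F. x = Inl (f ` A) \<and> y = Inr (g ` A)) x y}"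

text \<open>The faces of the glued complex are identification classes; one class lies below another
  iff some representatives belong to the same polytope and are related by inclusion.\<close>

definition sum_complex ::
  "'d::finite space set \<Rightarrow> 'd space set \<Rightarrow> 'd space set \<Rightarrow>
   ('d space \<Rightarrow> 'd space) \<Rightarrow> ('d space \<Rightarrow> 'd space) \<Rightarrow> ('d space set + 'd space set) set rel" where
  "sum_complex P Q F f g =
     {(X, Y). X \<in> sum_cells P Q F f g // sum_identification F f g \<and>
              Y \<in> sum_cells P Q F f g // sum_identification F f g \<and>
              (\<exists>x\<in>X. \<exists>y\<in>Y. rel_sum (\<subseteq>) (\<subseteq>) x y)}"

definition adjoin_top :: "'a rel \<Rightarrow> 'a option rel" where
  "adjoin_top r = map_prod Some Some ` r \<union> (insert None (Some ` Field r)) \<times> {None}"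

text \<open>The face lattice of \<open>P #\<^sub>F Q\<close>: the glued boundary complex together with the polytope itself
  as top element.\<close>

definition connected_sum ::
  "'d::finite space set \<Rightarrow> 'd space set \<Rightarrow> 'd space set \<Rightarrow>
   ('d space \<Rightarrow> 'd space) \<Rightarrow> ('d space \<Rightarrow> 'd space) \<Rightarrow>
   ('d space set + 'd space set) set option rel" where
  "connected_sum P Q F f g = adjoin_top (sum_complex P Q F f g)"

end

theory Submission
  imports Defs
begin

text \<open>Moebius maps carry both facets to the same position \<open>F\<close>, and the Lorentz reflection in the
  hyperplane of \<open>F\<close> puts the two polytopes on opposite sides of it. Let \<open>G\<close> be a facet of \<open>F\<close> and
  \<open>T\<close> the hyperplane tangent to the light cone at the point where \<open>G\<close> touches it. The other facet
  through \<open>G\<close> of either polytope has a further ridge, whose tangency point lies strictly on the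
  side of \<open>T\<close> that contains the ball. So each polytope lies on that side of \<open>T\<close> and meets \<open>T\<close> only
  inside \<open>F\<close>. As these half-spaces cut out exactly \<open>F\<close> in the hyperplane of \<open>F\<close>, every segment
  from one polytope to the other crosses \<open>F\<close>: the union is convex. Since no facets become
  coplanar, its proper faces are those of the two polytopes other than \<open>F\<close>, and its ridges stay
  tangent.\<close>

section \<open>Pointed polyhedral cones\<close>

text \<open>The obstacle is convexity: at a ridge of the common facet the dihedral angles of two
  polytopes may add up to more than \<pi>. Tangency removes it. In the hyperbolic space inside the
  light cone, the hyperplanes of the two facets at a ridge share only the ideal point where the
  ridge touches the cone. They are asymptotic, with angle zero, so the hyperplane tangent at that
  point leaves both polytopes on one side. Everything is carried out on the cones over the
  polytopes. Hyperplanes then become linear functionals, and the study of the union (locale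
  \<open>glued_cones\<close>) mentions no Lorentz geometry at all. The reflection exists because the
  hyperplane of a facet contains a timelike vector, so that its normal is spacelike. Once the second
  cone has been reflected, the map carrying it back to \<open>Q\<close> induces \<open>g\<close>
  only on \<open>F\<close>; the connected sum uses \<open>g\<close> only through the images of
  \<open>F\<close> and of its faces.\<close>

definition pointed_cone :: "'a::euclidean_space set \<Rightarrow> bool" where
  "pointed_cone K \<longleftrightarrow> polyhedron K \<and> convex_cone K \<and> (\<forall>x\<in>K. - x \<in> K \<longrightarrow> x = 0)"

lemma pointed_coneD:
  assumes "pointed_cone K"
  shows "polyhedron K" "convex_cone K" "convex K" "closed K" "conic K" "0 \<in> K" "K \<noteq> {}"
    "\<And>x. x \<in> K \<Longrightarrow> - x \<in> K \<Longrightarrow> x = 0"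
  using assms polyhedron_imp_convex polyhedron_imp_closed convex_cone_contains_0
  unfolding pointed_cone_def convex_cone_def by blast+

lemma pointed_cone_scale: "pointed_cone K \<Longrightarrow> 0 \<le> c \<Longrightarrow> x \<in> K \<Longrightarrow> c *\<^sub>R x \<in> K"
  by (meson convex_cone_scaleR pointed_coneD(2))

lemma pointed_cone_face:
  assumes "pointed_cone K" "C face_of K" "C \<noteq> {}"
  shows "pointed_cone C"
proof -
  have "convex_cone C"
    using assms face_of_conic[of K C] face_of_imp_convex pointed_coneD[of K]
    unfolding convex_cone_def by blast
  then show ?thesis
    using assms face_of_polyhedron_polyhedron[of K C] face_of_imp_subset[of C K]
    unfolding pointed_cone_def by blast
qed

lemma face_ofI:
  assumes "C \<subseteq> S" "convex C"
    and "\<And>x y z. x \<in> S \<Longrightarrow> y \<in> S \<Longrightarrow> z \<in> C \<Longrightarrow> z \<in> open_segment x y \<Longrightarrow> x \<in> C \<and> y \<in> C"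
  shows "C face_of S"
  using assms unfolding face_of_def by blast

lemma convex_cone_face:
  assumes "pointed_cone K" "C face_of K" "C \<noteq> {}"
  shows "convex_cone C"
  using pointed_cone_face[OF assms] by (rule pointed_coneD(2))

lemma zero_face_of_pointed_cone:
  assumes "pointed_cone K"
  shows "{0} face_of K"
proof (rule face_ofI)
  show "{0} \<subseteq> K" using pointed_coneD(6)[OF assms] by simp
next
  fix x y z assume *: "x \<in> K" "y \<in> K" "z \<in> {0}" "z \<in> open_segment x y"
  then obtain u where u: "0 < u" "u < 1" "(1 - u) *\<^sub>R x + u *\<^sub>R y = 0" "x \<noteq> y"
    by (auto simp: in_segment)
  have "- (u *\<^sub>R y) = (1 - u) *\<^sub>R x"
    using iffD1[OF add_eq_0_iff u(3)] by simp
  moreover have "(1 - u) *\<^sub>R x \<in> K" "u *\<^sub>R y \<in> K"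
    using * u pointed_cone_scale[OF assms] by simp_all
  ultimately have "u *\<^sub>R y = 0" using pointed_coneD(8)[OF assms, of "u *\<^sub>R y"] by simp
  with u have "x = 0 \<and> y = 0" by simp
  then show "x \<in> {0} \<and> y \<in> {0}" by simp
qed simp

text \<open>A nonempty face of a pointed cone contains the apex, so the supporting hyperplane of a
  facet passes through 0 and its offset vanishes.\<close>

lemma pointed_cone_facetE:
  assumes "pointed_cone K" "C facet_of K"
  obtains a where "a \<noteq> 0" "\<And>x. x \<in> K \<Longrightarrow> 0 \<le> a \<bullet> x" "C = K \<inter> {x. a \<bullet> x = 0}"
proof -
  obtain a b where ab: "a \<noteq> 0" "K \<subseteq> {x. a \<bullet> x \<le> b}" "C = K \<inter> {x. a \<bullet> x = b}"
    using facet_of_polyhedron[OF pointed_coneD(1)[OF assms(1)] assms(2)] .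
  have "C face_of K" "C \<noteq> {}" using assms by (auto simp: facet_of_def)
  then have "0 \<in> C"
    using pointed_cone_face[OF assms(1)] pointed_coneD(6) by blast
  then have "b = 0" using ab(3) by auto
  then show ?thesis
    using ab by (intro that[of "- a"]) auto
qed

text \<open>The apex is a proper face, hence the intersection of the facets through it. A single
  such facet would have to be \<open>{0}\<close>, too small once \<open>K\<close> has dimension at
  least 2. As \<open>R'\<close> is arbitrary, this also serves as plain existence of a
  facet.\<close>

lemma pointed_cone_second_facet:
  assumes "pointed_cone K" "2 \<le> aff_dim K"
  obtains R where "R facet_of K" "R \<noteq> R'"
proof -
  have 0: "{0} face_of K" "{0} \<noteq> K"
    using zero_face_of_pointed_cone[OF assms(1)] assms(2) by auto
  have eq: "{0} = \<Inter>{F. F facet_of K \<and> {0} \<subseteq> F}"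
    by (rule face_of_polyhedron[OF pointed_coneD(1)[OF assms(1)] 0(1) _ 0(2)]) simp
  have "\<exists>R. R facet_of K \<and> R \<noteq> R'"
  proof (rule ccontr)
    assume "\<not> ?thesis"
    then have sub: "{F. F facet_of K \<and> {0} \<subseteq> F} \<subseteq> {R'}" by blast
    show False
    proof (cases "{F. F facet_of K \<and> {0} \<subseteq> F} = {}")
      case True
      then have "K \<subseteq> {0}" using eq by (metis Inter_empty top_greatest)
      then show False using 0(2) pointed_coneD(6)[OF assms(1)] by blast
    next
      case False
      then have "{F. F facet_of K \<and> {0} \<subseteq> F} = {R'}" using sub by blast
      then have "R' facet_of K" "R' = {0}" using eq by auto
      then show False using assms(2) by (simp add: facet_of_def)
    qed
  qed
  then show ?thesis using that by blast
qed

text \<open>Dimension drops strictly from \<open>S\<close> to a proper face \<open>C\<close> and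
  again from \<open>C\<close> to \<open>F\<close>, while a facet has codimension one.\<close>

lemma face_containing_facet:
  fixes S :: "'a::euclidean_space set"
  assumes "convex S" "F facet_of S" "C face_of S" "F \<subseteq> C" "C \<noteq> F"
  shows "C = S"
proof (rule ccontr)
  assume "C \<noteq> S"
  then have "aff_dim C < aff_dim S" using face_of_aff_dim_lt assms by blast
  moreover have "F face_of C"
    using assms by (meson face_of_imp_subset face_of_subset facet_of_imp_face_of)
  then have "aff_dim F < aff_dim C"
    using face_of_aff_dim_lt assms face_of_imp_convex by metis
  ultimately show False using assms(2) by (simp add: facet_of_def)
qed

lemma face_proper_in_facet:
  assumes "pointed_cone K" "C face_of K" "C \<noteq> {}" "C \<noteq> K"
  obtains R where "R facet_of K" "C \<subseteq> R"
  using face_of_polyhedron_subset_facet[OF pointed_coneD(1)[OF assms(1)] assms(2-4)] .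

section \<open>Functionals vanishing on sets of codimension one and two\<close>

lemma aff_dim_eq_dim_pointed: "pointed_cone K \<Longrightarrow> aff_dim K = int (dim K)"
  by (simp add: aff_dim_zero hull_inc pointed_coneD(6))

text \<open>The functionals vanishing on \<open>R\<close> form a plane, and \<open>y\<close> shows
  that \<open>a\<close> and \<open>t\<close> are independent in it. For a ridge \<open>R\<close>
  this expresses any facet functional through the functional of one facet and the tangent
  functional.\<close>

lemma span_pair_of_codim2:
  fixes R :: "'a::euclidean_space set"
  assumes "dim R + 2 = DIM('a)"
    and "\<And>x. x \<in> R \<Longrightarrow> a \<bullet> x = 0" "\<And>x. x \<in> R \<Longrightarrow> t \<bullet> x = 0" "\<And>x. x \<in> R \<Longrightarrow> b \<bullet> x = 0"
    and "a \<noteq> 0" "a \<bullet> y = 0" "t \<bullet> y \<noteq> 0"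
  obtains \<alpha> \<beta> where "b = \<alpha> *\<^sub>R a + \<beta> *\<^sub>R t"
proof -
  have "t \<notin> span {a}"
    using assms(6,7) by (auto simp: span_singleton)
  then have ind: "independent {t, a}" and "t \<noteq> a"
    using assms(5) span_base by (auto simp: independent_insert)
  have "dim (R \<union> {b, t, a}) = dim R + dim {b, t, a}"
    by (rule dim_orthogonal_sum) (use assms in \<open>auto simp: inner_commute\<close>)
  then have le: "dim {b, t, a} \<le> 2"
    using dim_subset_UNIV[of "R \<union> {b, t, a}"] assms(1) by simp
  have "b \<in> span {t, a}"
  proof (rule ccontr)
    assume "b \<notin> span {t, a}"
    then have "independent {b, t, a}" "b \<notin> {t, a}"
      using ind span_base[of b "{t, a}"] by (auto simp: independent_insert)
    then show False
      using le \<open>t \<noteq> a\<close> dim_eq_card_independent[of "{b, t, a}"] by simp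
  qed
  then obtain k where "b - k *\<^sub>R t \<in> span {a}"
    by (auto simp: span_breakdown_eq)
  then obtain l where "b - k *\<^sub>R t = l *\<^sub>R a" by (auto simp: span_singleton)
  then have "b = l *\<^sub>R a + k *\<^sub>R t" by (simp add: algebra_simps)
  then show ?thesis by (rule that)
qed

lemma span_single_of_codim1:
  fixes R :: "'a::euclidean_space set"
  assumes "dim R + 1 = DIM('a)"
    and "\<And>x. x \<in> R \<Longrightarrow> a \<bullet> x = 0" "\<And>x. x \<in> R \<Longrightarrow> b \<bullet> x = 0" "a \<noteq> 0"
  obtains c where "b = c *\<^sub>R a"
proof -
  have "dim (R \<union> {b, a}) = dim R + dim {b, a}"
    by (rule dim_orthogonal_sum) (use assms in \<open>auto simp: inner_commute\<close>)
  then have le: "dim {b, a} \<le> 1"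
    using dim_subset_UNIV[of "R \<union> {b, a}"] assms(1) by simp
  have "b \<in> span {a}"
  proof (rule ccontr)
    assume "b \<notin> span {a}"
    then have "independent {b, a}" "b \<noteq> a"
      using assms(4) span_base by (auto simp: independent_insert)
    then show False
      using le dim_eq_card_independent[of "{b, a}"] by simp
  qed
  then show ?thesis using that by (auto simp: span_singleton)
qed

lemma affine_hull_codim1:
  fixes F :: "'a::euclidean_space set"
  assumes "pointed_cone F" "dim F + 1 = DIM('a)" "a \<noteq> 0" "F \<subseteq> {x. a \<bullet> x = 0}"
  shows "affine hull F = {x. a \<bullet> x = 0}"
proof -
  have "affine hull F = span F"
    by (rule affine_hull_span_0[OF hull_inc[OF pointed_coneD(6)[OF assms(1)]]])
  also have "\<dots> = {x. a \<bullet> x = 0}"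
  proof (rule subspace_dim_equal)
    show "subspace (span F)" "subspace {x. a \<bullet> x = 0}" by (simp_all add: subspace_hyperplane)
    show "span F \<subseteq> {x. a \<bullet> x = 0}" using assms(4) by (simp add: span_minimal subspace_hyperplane)
    show "dim {x. a \<bullet> x = 0} \<le> dim (span F)" using assms(2,3) by (simp add: dim_hyperplane)
  qed
  finally show ?thesis .
qed

section \<open>Cones and their sections by the unit sphere\<close>

text \<open>Nonzero vectors are rescaled to the sphere. The cone \<open>{0}\<close> is covered too:
  its section is empty, and the convex cone hull of the empty set is \<open>{0}\<close>.\<close>

lemma convex_cone_hull_sphere:
  fixes C :: "'a::euclidean_space set"
  assumes "convex_cone C"
  shows "convex_cone hull (C \<inter> sphere 0 1) = C"
proof
  show "convex_cone hull (C \<inter> sphere 0 1) \<subseteq> C" using assms by (simp add: hull_minimal)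
  show "C \<subseteq> convex_cone hull (C \<inter> sphere 0 1)"
  proof
    fix x assume x: "x \<in> C"
    show "x \<in> convex_cone hull (C \<inter> sphere 0 1)"
    proof (cases "x = 0")
      case True then show ?thesis by (simp add: convex_cone_hull_contains_0)
    next
      case False
      then have "inverse (norm x) *\<^sub>R x \<in> C \<inter> sphere 0 1"
        using convex_cone_scaleR[OF assms _ x] by simp
      then have "norm x *\<^sub>R (inverse (norm x) *\<^sub>R x) \<in> convex_cone hull (C \<inter> sphere 0 1)"
        by (intro convex_cone_hull_mul hull_inc) simp_all
      then show ?thesis using False by simp
    qed
  qed
qed

lemma span_Int_sphere:
  fixes C :: "'a::euclidean_space set"
  assumes "convex_cone C"
  shows "span (C \<inter> sphere 0 1) = span C"
proof
  show "span (C \<inter> sphere 0 1) \<subseteq> span C" by (simp add: span_mono)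
  have "convex_cone hull (C \<inter> sphere 0 1) \<subseteq> span (C \<inter> sphere 0 1)"
    by (rule hull_minimal) (simp_all add: span_superset convex_cone_span)
  then have "C \<subseteq> span (C \<inter> sphere 0 1)" using convex_cone_hull_sphere[OF assms] by simp
  then show "span C \<subseteq> span (C \<inter> sphere 0 1)" by (simp add: span_minimal)
qed

section \<open>Gluing two cones along a common facet\<close>

text \<open>A roof functional witnesses a dihedral angle less than \<open>\<pi>\<close> at a ridge of the common facet.\<close>

definition roof :: "'a::euclidean_space set \<Rightarrow> 'a set \<Rightarrow> 'a \<Rightarrow> 'a \<Rightarrow> bool" where
  "roof P Q a t \<longleftrightarrow> (\<forall>x\<in>P \<union> Q. 0 \<le> t \<bullet> x \<and> (t \<bullet> x = 0 \<longrightarrow> a \<bullet> x = 0))"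

text \<open>The cones lie on opposite sides of the hyperplane of \<open>a\<close>. By
  \<open>facet_roof\<close> every ridge of \<open>F\<close> carries a roof, and by
  \<open>under_roof\<close> the roofs cut exactly \<open>F\<close> out of that hyperplane.
  \<open>facet_ex\<close> supplies at least one roof, which makes the union pointed.\<close>

locale glued_cones =
  fixes P Q F :: "'a::euclidean_space set" and a :: 'a
  assumes P: "pointed_cone P" and Q: "pointed_cone Q"
    and FP: "F facet_of P" and FQ: "F facet_of Q"
    and posP: "\<And>x. x \<in> P \<Longrightarrow> 0 \<le> a \<bullet> x" and F_P: "F = P \<inter> {x. a \<bullet> x = 0}"
    and negQ: "\<And>x. x \<in> Q \<Longrightarrow> a \<bullet> x \<le> 0" and F_Q: "F = Q \<inter> {x. a \<bullet> x = 0}"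
    and facet_ex: "\<exists>R. R facet_of F"
    and facet_roof: "\<And>R. R facet_of F \<Longrightarrow> \<exists>t. roof P Q a t \<and> (\<forall>x\<in>R. t \<bullet> x = 0)"
    and under_roof: "\<And>x. a \<bullet> x = 0 \<Longrightarrow> (\<And>t. roof P Q a t \<Longrightarrow> 0 \<le> t \<bullet> x) \<Longrightarrow> x \<in> F"
begin

text \<open>\<open>roof\<close> involves \<open>a\<close> only through its vanishing, so it survives
  the change of sign. Results about faces of \<open>P\<close> thereby transfer to
  \<open>Q\<close>.\<close>

lemma swap: "glued_cones Q P F (- a)"
proof -
  have r: "roof Q P (- a) t \<longleftrightarrow> roof P Q a t" for t
    by (simp add: roof_def Un_commute)
  show ?thesis
  proof (unfold_locales, unfold r)
    show "x \<in> F" if "- a \<bullet> x = 0" "\<And>t. roof P Q a t \<Longrightarrow> 0 \<le> t \<bullet> x" for x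
      using that by (intro under_roof) auto
  qed (fact P Q FP FQ facet_ex facet_roof | use posP negQ F_P F_Q in simp)+
qed

lemma F_cone: "pointed_cone F"
  using pointed_cone_face[OF P] FP by (simp add: facet_of_def)

lemma F_sub: "F \<subseteq> P" "F \<subseteq> Q"
  using F_P F_Q by auto

lemma mem_F: "x \<in> P \<union> Q \<Longrightarrow> a \<bullet> x = 0 \<Longrightarrow> x \<in> F"
  using F_P F_Q by blast

lemma Int_eq: "P \<inter> Q = F"
  using F_P F_Q posP negQ by force

section \<open>Convexity of the union\<close>

lemma crossing:
  assumes "x \<in> P" "y \<in> Q"
  obtains w where "w \<in> closed_segment x y" "w \<in> F"
proof -
  have xy: "0 \<le> a \<bullet> x" "a \<bullet> y \<le> 0" using assms posP negQ by auto
  show ?thesis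
  proof (cases "a \<bullet> x = a \<bullet> y")
    case True
    then have "x \<in> F" using xy assms mem_F by force
    then show ?thesis by (intro that[of x]) auto
  next
    case False
    \<comment> \<open>The parameter at which the segment meets the hyperplane of \<open>a\<close>;
      there the roofs are nonnegative, being nonnegative at both ends.\<close>
    define u where "u = a \<bullet> x / (a \<bullet> x - a \<bullet> y)"
    have u: "0 \<le> u" "u \<le> 1" using xy False by (auto simp: u_def field_simps)
    define w where "w = (1 - u) *\<^sub>R x + u *\<^sub>R y"
    have "a \<bullet> w = a \<bullet> x - u * (a \<bullet> x - a \<bullet> y)"
      by (simp add: w_def inner_simps algebra_simps)
    also have "\<dots> = 0" using False by (simp add: u_def)
    finally have "a \<bullet> w = 0" .
    moreover have "0 \<le> t \<bullet> w" if "roof P Q a t" for t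
      using that assms u by (auto simp: roof_def w_def inner_simps)
    ultimately have "w \<in> F" by (rule under_roof)
    moreover have "w \<in> closed_segment x y"
      using u by (auto simp: w_def in_segment)
    ultimately show ?thesis using that by blast
  qed
qed

lemma convex_Un: "convex (P \<union> Q)"
proof -
  have seg: "closed_segment x y \<subseteq> P \<union> Q" if "x \<in> P" "y \<in> Q" for x y
  proof -
    obtain w where w: "w \<in> closed_segment x y" "w \<in> F"
      using crossing \<open>x \<in> P\<close> \<open>y \<in> Q\<close> by blast
    have "closed_segment x w \<subseteq> P" "closed_segment w y \<subseteq> Q"
        using that w(2) F_sub pointed_coneD(3)[OF P] pointed_coneD(3)[OF Q]
      by (meson closed_segment_subset subsetD)+
    then show ?thesis using Un_closed_segment[OF w(1)] by blast
  qed
  have P': "closed_segment x y \<subseteq> P" if "x \<in> P" "y \<in> P" for x y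
    using that P by (simp add: closed_segment_subset pointed_coneD(3))
  have Q': "closed_segment x y \<subseteq> Q" if "x \<in> Q" "y \<in> Q" for x y
    using that Q by (simp add: closed_segment_subset pointed_coneD(3))
  show ?thesis
    unfolding convex_contains_segment
    using seg P' Q' by (metis Un_iff closed_segment_commute le_supI1 le_supI2)
qed

section \<open>Faces of the union\<close>

lemma proper_face_F_roof:
  assumes "C face_of F" "C \<noteq> F" "C \<noteq> {}"
  obtains t where "roof P Q a t" "\<And>x. x \<in> C \<Longrightarrow> t \<bullet> x = 0"
  using face_proper_in_facet[OF F_cone assms(1,3,2)] facet_roof by (metis subsetD)

text \<open>A roof vanishing on \<open>C\<close> supports the union, and its zero set there lies
  inside \<open>F\<close>. So \<open>C\<close> is a face of that zero set, which is itself a face of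
  the union.\<close>

lemma face_F_is_face:
  assumes "C face_of F" "C \<noteq> F"
  shows "C face_of P \<union> Q"
proof (cases "C = {}")
  case False
  obtain t where t: "roof P Q a t" "\<And>x. x \<in> C \<Longrightarrow> t \<bullet> x = 0"
    using proper_face_F_roof assms False by blast
  define R where "R = (P \<union> Q) \<inter> {x. t \<bullet> x = 0}"
  have R: "R face_of P \<union> Q"
    unfolding R_def
    by (rule face_of_Int_supporting_hyperplane_ge) (use t(1) convex_Un in \<open>auto simp: roof_def\<close>)
  have "R \<subseteq> F" using t(1) mem_F by (auto simp: R_def roof_def)
  moreover have "C \<subseteq> R"
    using t(2) face_of_imp_subset[OF assms(1)] F_sub by (auto simp: R_def)
  ultimately have "C face_of R" using assms(1) face_of_subset by blast
  with R show ?thesis using face_of_trans by blast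
qed simp

text \<open>Only a segment that leaves \<open>P\<close> can violate the face property. If it ends at
  \<open>x\<close> outside \<open>P\<close> and passes through \<open>z\<close> in \<open>C\<close>,
  take \<open>w\<close> in \<open>C\<close> off \<open>F\<close>, and let \<open>v\<close> be the
  point where the segment from \<open>w\<close> to \<open>x\<close> crosses \<open>F\<close>.
  Shrinking the segment towards \<open>w\<close> moves it into \<open>P\<close>, and the face
  property there yields first the shrunken endpoint and then \<open>v\<close> in \<open>C\<close>. A
  roof vanishing on the proper face \<open>C \<inter> F\<close> of \<open>F\<close> then vanishes at
  \<open>v\<close>, hence at \<open>w\<close>, which forces \<open>w\<close> into the hyperplane of
  \<open>F\<close>.\<close>

lemma face_P_is_face:
  assumes C: "C face_of P" "C \<noteq> P" "C \<noteq> F"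
  shows "C face_of P \<union> Q"
proof (cases "C \<subseteq> F")
  case True
  then show ?thesis
    by (intro face_F_is_face face_of_subset[OF C(1)]) (use True C(3) F_sub in auto)
next
  case False
  have CP: "C \<subseteq> P" using C face_of_imp_subset by blast
  obtain w where w: "w \<in> C" "w \<in> P" "0 < a \<bullet> w"
    using False CP posP F_P by force
  have key: "x \<in> P" if xy: "x \<in> P \<union> Q" "y \<in> P \<union> Q" and z: "z \<in> C" "z \<in> open_segment x y"
    for x y z
  proof (rule ccontr)
    assume "x \<notin> P"
    then have xQ: "x \<in> Q" and "x \<notin> F" using xy F_sub by auto
    then have ax: "a \<bullet> x < 0" using negQ[OF xQ] mem_F xy(1) by force
    obtain v where v: "v \<in> closed_segment w x" "v \<in> F"
      using crossing w(2) xQ by blast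
    have av: "a \<bullet> v = 0" using v(2) F_P by auto
    from v(1) obtain r where r: "0 \<le> r" "r \<le> 1" "v = (1 - r) *\<^sub>R w + r *\<^sub>R x"
      by (auto simp: in_segment)
    have avr: "(1 - r) * (a \<bullet> w) + r * (a \<bullet> x) = 0"
      using av r(3) by (simp add: inner_simps)
    have "r \<noteq> 0" "r \<noteq> 1" using avr w(3) ax by auto
    then have r01: "0 < r" "r < 1" using r by auto
    obtain z' where zz: "0 < z'" "z' < 1" "z = (1 - z') *\<^sub>R x + z' *\<^sub>R y" "x \<noteq> y"
      using z(2) by (auto simp: in_segment)
    \<comment> \<open>The first bound keeps the image of \<open>x\<close> strictly before the
      crossing point \<open>v\<close>; the second keeps the image of \<open>y\<close> on the
      positive side of \<open>a\<close>.\<close>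
    define s where "s = min (r / 2) (a \<bullet> w / (2 * (a \<bullet> w + \<bar>a \<bullet> y\<bar>)))"
    have s: "0 < s" "s < r" using r01 w(3) by (auto simp: s_def)
    have sy: "0 < (1 - s) * (a \<bullet> w) + s * (a \<bullet> y)"
    proof -
      have "s * (a \<bullet> w + \<bar>a \<bullet> y\<bar>) \<le> (a \<bullet> w / (2 * (a \<bullet> w + \<bar>a \<bullet> y\<bar>))) * (a \<bullet> w + \<bar>a \<bullet> y\<bar>)"
        by (rule mult_right_mono) (use w(3) in \<open>auto simp: s_def\<close>)
      also have "\<dots> = a \<bullet> w / 2" using w(3) by (simp add: field_simps)
      also have "\<dots> < a \<bullet> w" using w(3) by simp
      finally have "s * (a \<bullet> w) + s * \<bar>a \<bullet> y\<bar> < a \<bullet> w" by (simp add: algebra_simps)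
      moreover have "s * \<bar>a \<bullet> y\<bar> \<ge> - (s * (a \<bullet> y))"
        using s(1) by (metis abs_ge_minus_self mult_left_mono less_imp_le mult_minus_right)
      ultimately show ?thesis by (simp add: algebra_simps)
    qed
    have sx: "0 < (1 - s) * (a \<bullet> w) + s * (a \<bullet> x)"
    proof -
      have "(1 - s) * (a \<bullet> w) + s * (a \<bullet> x) = (r - s) * (a \<bullet> w - a \<bullet> x)"
        using avr by (simp add: algebra_simps)
      then show ?thesis using s w(3) ax by simp
    qed
    define x' y' where "x' = (1 - s) *\<^sub>R w + s *\<^sub>R x" and "y' = (1 - s) *\<^sub>R w + s *\<^sub>R y"
    have s1: "s < 1" using s r01 by simp
    have wU: "w \<in> P \<union> Q" using w by blast
    have "x' \<in> P \<union> Q" "y' \<in> P \<union> Q"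
      using convexD[OF convex_Un wU xy(1), of "1 - s" s] convexD[OF convex_Un wU xy(2), of "1 - s" s]
        s s1 by (auto simp: x'_def y'_def)
    moreover have "0 < a \<bullet> x'" "0 < a \<bullet> y'"
      using sx sy by (simp_all add: x'_def y'_def inner_simps)
    ultimately have P': "x' \<in> P" "y' \<in> P" using negQ by (meson UnE not_less)+
    have "(1 - s) *\<^sub>R w + s *\<^sub>R z \<in> C"
      using convexD[OF face_of_imp_convex[OF C(1)] w(1) z(1), of "1 - s" s] s s1 by simp
    moreover have "(1 - s) *\<^sub>R w + s *\<^sub>R z = (1 - z') *\<^sub>R x' + z' *\<^sub>R y'"
      by (simp add: x'_def y'_def zz(3) algebra_simps)
    moreover have "x' \<noteq> y'" using zz(4) s by (simp add: x'_def y'_def)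
    ultimately have "x' \<in> C"
      using face_ofD[OF C(1), of "(1 - s) *\<^sub>R w + s *\<^sub>R z" x' y'] P' zz(1,2)
      unfolding in_segment by metis
    \<comment> \<open>The shrunken endpoint lies strictly between \<open>w\<close> and
      \<open>v\<close>, both in \<open>P\<close>, so the face property of \<open>C\<close> now
      captures \<open>v\<close>.\<close>
    moreover have "x' = (1 - s / r) *\<^sub>R w + (s / r) *\<^sub>R v"
      using r01 by (simp add: x'_def r(3) algebra_simps)
    moreover have "w \<noteq> v" using av w(3) by auto
    moreover have "0 < s / r" "s / r < 1" using s r01 by simp_all
    moreover have "v \<in> P" using v F_sub by blast
    ultimately have vC: "v \<in> C"
      using face_ofD[OF C(1), of x' w v] w(2) unfolding in_segment by metis
    have "C \<inter> F face_of F"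
      by (rule face_of_subset[OF face_of_Int[OF C(1) facet_of_imp_face_of[OF FP]]])
        (use F_sub in auto)
    moreover have "C \<inter> F \<noteq> F"
      using face_containing_facet[OF pointed_coneD(3)[OF P] FP C(1)] C(2,3) by auto
    moreover have "C \<inter> F \<noteq> {}" using vC v(2) by auto
    ultimately obtain t where t: "roof P Q a t" "\<And>x. x \<in> C \<inter> F \<Longrightarrow> t \<bullet> x = 0"
      by (rule proper_face_F_roof) blast
    have "(1 - r) * (t \<bullet> w) + r * (t \<bullet> x) = 0"
      using t(2)[of v] vC v(2) r(3) by (simp add: inner_simps)
    moreover have "0 \<le> t \<bullet> w" "0 \<le> t \<bullet> x" using t(1) w(2) xQ by (auto simp: roof_def)
    ultimately have "t \<bullet> w = 0"
      using r01 by (smt (verit) mult_nonneg_nonneg mult_pos_pos)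
    then show False using t(1) w by (auto simp: roof_def)
  qed
  show ?thesis
  proof (rule face_ofI)
    show "C \<subseteq> P \<union> Q" using CP by blast
    show "convex C" using C face_of_imp_convex by blast
    fix x y z assume *: "x \<in> P \<union> Q" "y \<in> P \<union> Q" "z \<in> C" "z \<in> open_segment x y"
    have "x \<in> P" by (rule key[OF *])
    moreover have "y \<in> P" by (rule key[OF *(2,1,3)]) (use *(4) open_segment_commute in blast)
    ultimately show "x \<in> C \<and> y \<in> C" using face_ofD[OF C(1) *(4)] *(3) by blast
  qed
qed

text \<open>A segment joining points of \<open>P\<close> and \<open>Q\<close> off \<open>F\<close>
  crosses \<open>F\<close> in its interior, while its ends stay outside.\<close>

lemma F_not_face: "\<not> F face_of P \<union> Q"
proof
  assume F: "F face_of P \<union> Q"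
  have "F \<noteq> P" "F \<noteq> Q" using FP FQ by auto
  then obtain x y where xy: "x \<in> P" "x \<notin> F" "y \<in> Q" "y \<notin> F" using F_sub by blast
  then obtain w where w: "w \<in> closed_segment x y" "w \<in> F" using crossing by blast
  then have "w \<in> open_segment x y" using xy by (auto simp: open_segment_def)
  then show False using face_ofD[OF F, of w x y] xy w by blast
qed

lemma P_not_face: "\<not> P face_of P \<union> Q"
  by (meson F_not_face FP face_of_trans facet_of_imp_face_of)

lemma face_Un_in_P:
  assumes "C face_of P \<union> Q" "C \<subseteq> P"
  shows "C face_of P" "C \<noteq> P" "C \<noteq> F"
  using assms F_not_face P_not_face face_of_subset[of C "P \<union> Q" P] by auto

lemma face_Un_in_Q:
  assumes "C face_of P \<union> Q" "C \<subseteq> Q"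
  shows "C face_of Q" "C \<noteq> Q" "C \<noteq> F"
  using glued_cones.face_Un_in_P[OF swap, of C] assms by (auto simp: Un_commute)

lemma face_Q_is_face:
  assumes "C face_of Q" "C \<noteq> Q" "C \<noteq> F"
  shows "C face_of P \<union> Q"
  using glued_cones.face_P_is_face[OF swap, of C] assms by (simp add: Un_commute)

text \<open>If \<open>C\<close> had points in both cones off \<open>F\<close>, a segment between
  them would cross \<open>F\<close>, and at a relative interior point: elsewhere some roof would
  vanish there and so at both ends. A face meeting the relative interior of \<open>F\<close>
  contains \<open>F\<close>. Its intersections with \<open>P\<close> and \<open>Q\<close> then
  exceed a facet, so they are all of \<open>P\<close> and all of \<open>Q\<close>.\<close>

lemma face_Un_cases:
  assumes C: "C face_of P \<union> Q" "C \<noteq> P \<union> Q"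
  shows "C \<subseteq> P \<or> C \<subseteq> Q"
proof (rule ccontr)
  assume "\<not> ?thesis"
  then obtain x y where xy: "x \<in> C" "x \<notin> P" "y \<in> C" "y \<notin> Q" by blast
  then have xQ: "x \<in> Q" and yP: "y \<in> P" using face_of_imp_subset[OF C(1)] by auto
  then have xF: "x \<notin> F" and yF: "y \<notin> F" using xy F_sub by auto
  obtain w where w: "w \<in> closed_segment y x" "w \<in> F" using crossing[OF yP xQ] by blast
  then have wo: "w \<in> open_segment y x" using xF yF by (auto simp: open_segment_def)
  have wC: "w \<in> C"
    using closed_segment_subset[OF xy(3,1) face_of_imp_convex[OF C(1)]] w by blast
  have "w \<in> rel_interior F"
  proof (rule ccontr)
    assume "w \<notin> rel_interior F"
    then obtain R where "R facet_of F" "w \<in> R"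
      using rel_boundary_of_polyhedron[OF pointed_coneD(1)[OF F_cone]] w(2) by blast
    then obtain t where t: "roof P Q a t" "t \<bullet> w = 0" using facet_roof by blast
    obtain u where u: "0 < u" "u < 1" "w = (1 - u) *\<^sub>R y + u *\<^sub>R x"
      using wo by (auto simp: in_segment)
    have "(1 - u) * (t \<bullet> y) + u * (t \<bullet> x) = 0" using t(2) u(3) by (simp add: inner_simps)
    moreover have "0 \<le> t \<bullet> x" "0 \<le> t \<bullet> y" using t(1) xQ yP by (auto simp: roof_def)
    ultimately have "t \<bullet> x = 0"
      using u by (smt (verit) mult_nonneg_nonneg mult_pos_pos)
    then have "a \<bullet> x = 0" using t(1) xQ by (auto simp: roof_def)
    then show False using mem_F xQ xF by blast
  qed
  then have FC: "F \<subseteq> C"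
    using subset_of_face_of[OF C(1), of F] F_sub wC by blast
  have "C \<inter> P face_of P" "C \<inter> Q face_of Q"
    using face_of_slice[OF C(1) pointed_coneD(3)[OF P]] face_of_slice[OF C(1) pointed_coneD(3)[OF Q]]
    by (simp_all add: Int_absorb1)
  then have "C \<inter> P = P" "C \<inter> Q = Q"
    using face_containing_facet[OF pointed_coneD(3)[OF P] FP, of "C \<inter> P"]
      face_containing_facet[OF pointed_coneD(3)[OF Q] FQ, of "C \<inter> Q"] FC F_sub xy xQ yP xF yF
    by blast+
  then show False using C(2) face_of_imp_subset[OF C(1)] by blast
qed

text \<open>Polyhedrality comes from counting: a closed convex set with finitely many faces is a
  polyhedron, and each proper face of the union is a face of \<open>P\<close> or of
  \<open>Q\<close>. For pointedness, a roof vanishes at \<open>x\<close> when \<open>x\<close> is in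
  \<open>P\<close> and \<open>- x\<close> in \<open>Q\<close>, which puts both into the pointed cone
  \<open>F\<close>.\<close>

lemma pointed_cone_Un: "pointed_cone (P \<union> Q)"
proof -
  have "{C. C face_of P \<union> Q} \<subseteq> insert (P \<union> Q) ({C. C face_of P} \<union> {C. C face_of Q})"
  proof
    fix C assume "C \<in> {C. C face_of P \<union> Q}"
    then have C: "C face_of P \<union> Q" by simp
    show "C \<in> insert (P \<union> Q) ({C. C face_of P} \<union> {C. C face_of Q})"
      using face_Un_cases[OF C] face_Un_in_P(1)[OF C] face_Un_in_Q(1)[OF C] by auto
  qed
  then have "finite {C. C face_of P \<union> Q}"
    by (rule finite_subset)
      (simp add: finite_polyhedron_faces pointed_coneD(1)[OF P] pointed_coneD(1)[OF Q])
  then have "polyhedron (P \<union> Q)"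
    unfolding polyhedron_eq_finite_faces
    using convex_Un closed_Un[OF pointed_coneD(4)[OF P] pointed_coneD(4)[OF Q]] by simp
  moreover have "conic (P \<union> Q)"
    using pointed_coneD(5)[OF P] pointed_coneD(5)[OF Q] unfolding conic_def by simp
  then have "convex_cone (P \<union> Q)"
    using convex_Un pointed_coneD(7)[OF P] by (simp add: convex_cone_def)
  moreover have "x = 0" if "x \<in> P" "- x \<in> Q" for x
  proof -
    obtain R where "R facet_of F" using facet_ex ..
    then obtain t where t: "roof P Q a t" using facet_roof by blast
    have "0 \<le> t \<bullet> x" "0 \<le> - (t \<bullet> x)" using t that by (force simp: roof_def)+
    then have "t \<bullet> x = 0" by simp
    then have "a \<bullet> x = 0" using t that by (auto simp: roof_def)
    then have "x \<in> F" "- x \<in> F" using mem_F that by auto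
    then show "x = 0" using pointed_coneD(8)[OF F_cone] by blast
  qed
  then have "x = 0" if "x \<in> P \<union> Q" "- x \<in> P \<union> Q" for x
    using that pointed_coneD(8)[OF P, of x] pointed_coneD(8)[OF Q, of x]
    by (metis Un_iff minus_minus neg_equal_0_iff_equal)
  ultimately show ?thesis unfolding pointed_cone_def by blast
qed

end

section \<open>The Lorentz form\<close>

text \<open>\<open>mirror x \<bullet> y\<close> is the Lorentz form, with the sign that makes it positive on future timelike
  vectors.\<close>

definition mirror :: "'d::finite space \<Rightarrow> 'd space" where
  "mirror x = (fst x, - snd x)"

lemma mirror_inner: "mirror x \<bullet> y = fst x * fst y - snd x \<bullet> snd y"
  by (simp add: mirror_def inner_prod_def)

lemma mirror_sym: "mirror x \<bullet> y = x \<bullet> mirror y"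
  by (simp add: mirror_def inner_prod_def)

lemma mirror_mirror [simp]: "mirror (mirror x) = x"
  by (simp add: mirror_def)

lemma mem_lorentz_cone: "x \<in> lorentz_cone \<longleftrightarrow> norm (snd x) \<le> fst x"
proof -
  have "(\<Sum>i\<in>UNIV. (snd x $ i)\<^sup>2) = (norm (snd x))\<^sup>2"
    unfolding power2_norm_eq_inner by (simp add: inner_vec_def power2_eq_square)
  moreover have "norm (snd x) \<le> fst x \<Longrightarrow> 0 \<le> fst x" using norm_ge_zero order_trans by blast
  ultimately show ?thesis
    by (auto simp: lorentz_cone_def power_mono_iff intro: power2_le_imp_le power_mono)
qed

lemma mem_lorentz_cone_form: "x \<in> lorentz_cone \<longleftrightarrow> 0 \<le> fst x \<and> 0 \<le> mirror x \<bullet> x"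
proof -
  have "(\<Sum>i\<in>UNIV. (snd x $ i)\<^sup>2) = snd x \<bullet> snd x"
    by (simp add: inner_vec_def power2_eq_square)
  then show ?thesis
    by (auto simp: lorentz_cone_def mirror_inner power2_eq_square)
qed

lemma closed_lorentz_cone: "closed lorentz_cone"
proof -
  have "lorentz_cone = {x :: 'a space. norm (snd x) \<le> fst x}"
    using mem_lorentz_cone by blast
  also have "closed \<dots>"
    by (intro closed_Collect_le continuous_intros)
  finally show ?thesis .
qed

lemma lorentz_cone_scale: "x \<in> lorentz_cone \<Longrightarrow> 0 \<le> c \<Longrightarrow> c *\<^sub>R x \<in> lorentz_cone"
  by (simp add: mem_lorentz_cone mult_left_mono)

lemma interior_lorentz_coneI: "norm (snd x) < fst x \<Longrightarrow> x \<in> interior lorentz_cone"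
proof -
  assume x: "norm (snd x) < fst x"
  have "open {x :: 'a space. norm (snd x) < fst x}"
    by (intro open_Collect_less continuous_intros)
  moreover have "{x :: 'a space. norm (snd x) < fst x} \<subseteq> lorentz_cone"
    by (auto simp: mem_lorentz_cone)
  ultimately show ?thesis using x by (meson interiorI mem_Collect_eq)
qed

lemma zero_notin_interior_lorentz_cone: "0 \<notin> interior lorentz_cone"
proof
  assume "(0 :: 'a space) \<in> interior lorentz_cone"
  then obtain e where e: "0 < e" "ball (0 :: 'a space) e \<subseteq> lorentz_cone"
    by (meson mem_interior)
  have "(- e / 2, 0 :: real ^ 'a) \<in> ball 0 e"
    using e(1) by (simp add: norm_Pair)
  then have "(- e / 2, 0 :: real ^ 'a) \<in> lorentz_cone" using e(2) by blast
  then show False using e(1) by (simp add: mem_lorentz_cone)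
qed

lemma interior_lorentz_cone_scale:
  assumes "x \<in> interior lorentz_cone" "0 < c"
  shows "c *\<^sub>R x \<in> interior lorentz_cone"
proof -
  have "c *\<^sub>R x \<in> (*\<^sub>R) c ` interior lorentz_cone" using assms by blast
  also have "\<dots> = interior ((*\<^sub>R) c ` lorentz_cone)"
    by (rule interior_injective_linear_image[symmetric]) (use assms in \<open>auto simp: inj_on_def\<close>)
  also have "\<dots> \<subseteq> interior lorentz_cone"
    by (rule interior_mono) (use assms(2) lorentz_cone_scale in force)
  finally show ?thesis .
qed

text \<open>The radial preimage of a relatively open subset of the sphere is open in the punctured
  space, and it stays in the cone by scaling.\<close>

lemma scribing_ball_interior:
  "(top_of_set (sphere 0 1)) interior_of (scribing_ball :: 'd::finite space set) =
     interior lorentz_cone \<inter> sphere 0 1"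
proof (rule interior_of_unique)
  show "interior lorentz_cone \<inter> sphere 0 1 \<subseteq> (scribing_ball :: 'd space set)"
    using interior_subset by (auto simp: scribing_ball_def)
  show "openin (top_of_set (sphere 0 1)) (interior lorentz_cone \<inter> sphere 0 1 :: 'd space set)"
    by (metis inf_commute open_interior openin_open_Int)
  fix T :: "'d space set"
  assume T: "T \<subseteq> scribing_ball" "openin (top_of_set (sphere 0 1)) T"
  then obtain U where U: "open U" "T = sphere 0 1 \<inter> U" by (auto simp: openin_open)
  have "open (sgn -` U \<inter> (- {0} :: 'd space set))"
    by (rule continuous_open_preimage[of "- {0}" sgn U, unfolded Int_commute[of "- {0}"]])
      (auto intro!: continuous_on_sgn continuous_on_id simp: U(1))
  moreover have "sgn -` U \<inter> (- {0}) \<subseteq> (lorentz_cone :: 'd space set)"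
  proof
    fix x :: "'d space" assume x: "x \<in> sgn -` U \<inter> (- {0})"
    then have "sgn x \<in> T" using U(2) by (auto simp: norm_sgn)
    then have "sgn x \<in> lorentz_cone" using T by (auto simp: scribing_ball_def)
    then have "norm x *\<^sub>R sgn x \<in> lorentz_cone" by (simp add: lorentz_cone_scale)
    then show "x \<in> lorentz_cone" using x by (simp add: sgn_div_norm)
  qed
  ultimately have "sgn -` U \<inter> (- {0}) \<subseteq> interior (lorentz_cone :: 'd space set)"
    by (simp add: interior_maximal)
  moreover have "T \<subseteq> sgn -` U \<inter> (- {0})"
    using U(2) by (auto simp: sgn_div_norm)
  ultimately show "T \<subseteq> interior lorentz_cone \<inter> sphere 0 1" using U(2) by blast
qed

lemma scribing_sphere_eq:
  "scribing_sphere = (lorentz_cone - interior lorentz_cone) \<inter> sphere 0 1"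
proof -
  have "closedin (top_of_set (sphere 0 1)) scribing_ball"
    unfolding scribing_ball_def using closed_lorentz_cone
    by (metis closedin_closed_Int inf_commute)
  then show ?thesis
    unfolding scribing_sphere_def frontier_of_def scribing_ball_interior
    by (subst closure_of_closedin) (auto simp: scribing_ball_def)
qed

text \<open>Cauchy-Schwarz for the spatial parts. For lightlike \<open>p\<close> this is the tangent
  hyperplane of the cone along the ray of \<open>p\<close>.\<close>

lemma support_lorentz_cone:
  assumes "p \<in> lorentz_cone" "x \<in> lorentz_cone"
  shows "0 \<le> mirror p \<bullet> x"
proof -
  have "snd p \<bullet> snd x \<le> norm (snd p) * norm (snd x)" by (rule norm_cauchy_schwarz)
  also have "\<dots> \<le> fst p * fst x"
    using assms norm_ge_zero[of "snd p"] order_trans[OF norm_ge_zero]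
    by (intro mult_mono) (auto simp: mem_lorentz_cone)
  finally show ?thesis by (simp add: mirror_inner)
qed

text \<open>Vanishing forces equality in Cauchy-Schwarz, so \<open>x\<close> is lightlike and
  parallel to \<open>p\<close>; the unit norms then make them equal.\<close>

lemma strict_support_lorentz_cone:
  assumes p: "norm (snd p) = fst p" "norm p = 1" and x: "x \<in> lorentz_cone" "norm x = 1"
    and "x \<noteq> p"
  shows "0 < mirror p \<bullet> x"
proof (rule ccontr)
  assume "\<not> ?thesis"
  moreover have "p \<in> lorentz_cone" using p by (simp add: mem_lorentz_cone)
  ultimately have "mirror p \<bullet> x = 0" using support_lorentz_cone[of p x] x by simp
  then have eq: "fst p * fst x = snd p \<bullet> snd x" by (simp add: mirror_inner)
  have sq: "(fst z)\<^sup>2 + (norm (snd z))\<^sup>2 = 1" if "norm z = 1" for z :: "'a space"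
    using that by (metis norm_Pair prod.collapse real_norm_def power2_abs real_sqrt_eq_1_iff)
  have p0: "0 < fst p" using p sq[of p] by (metis norm_ge_zero less_eq_real_def power_zero_numeral add_0 zero_neq_one)
  have cs: "snd p \<bullet> snd x \<le> norm (snd p) * norm (snd x)" by (rule norm_cauchy_schwarz)
  have "fst p * fst x \<le> fst p * norm (snd x)" using eq cs p by simp
  then have "fst x \<le> norm (snd x)" using p0 by simp
  then have x0: "norm (snd x) = fst x" using x by (simp add: mem_lorentz_cone)
  then have "snd p \<bullet> snd x = norm (snd p) * norm (snd x)" using eq p by simp
  then have "fst p *\<^sub>R snd x = fst x *\<^sub>R snd p"
    unfolding norm_cauchy_schwarz_eq using p x0 by simp
  moreover have "(fst p)\<^sup>2 = (fst x)\<^sup>2" using sq[of p] sq[of x] p x x0 by simp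
  then have "fst p = fst x"
    using p0 x0 norm_ge_zero[of "snd x"] power2_eq_imp_eq[of "fst p" "fst x"] by linarith
  ultimately show False using p0 assms(5) by (simp add: prod_eq_iff)
qed

section \<open>Tangent ridges\<close>

text \<open>The interior of the light cone is stable under positive scaling and misses 0, so
  avoiding it can be tested on the whole span instead of its section.\<close>

lemma tangent_face_cone:
  assumes "convex_cone C"
  shows "tangent_face (C \<inter> sphere 0 1) \<longleftrightarrow>
    is_singleton (rel_interior C \<inter> (lorentz_cone - interior lorentz_cone) \<inter> sphere 0 1) \<and>
    span C \<inter> interior lorentz_cone = {}"
proof -
  have "v \<notin> span C" if "span C \<inter> sphere 0 1 \<inter> interior lorentz_cone = {}"
    and v: "v \<in> interior lorentz_cone" for v
  proof
    assume "v \<in> span C"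
    moreover have "v \<noteq> 0" using v zero_notin_interior_lorentz_cone by blast
    ultimately have "inverse (norm v) *\<^sub>R v \<in> span C \<inter> sphere 0 1 \<inter> interior lorentz_cone"
      using v by (simp add: interior_lorentz_cone_scale span_scale)
    then show False using that by blast
  qed
  then have *: "span C \<inter> sphere 0 1 \<inter> (interior lorentz_cone \<inter> sphere 0 1) = {} \<longleftrightarrow>
      span C \<inter> interior lorentz_cone = {}" by blast
  show ?thesis
    unfolding tangent_face_def spherical_relint_def spherical_span_def scribing_sphere_eq
      scribing_ball_interior convex_cone_hull_sphere[OF assms] span_Int_sphere[OF assms] *
    by (simp add: Int_ac)
qed

text \<open>A first-order argument at the lightlike point \<open>p\<close>: along
  \<open>p + e *\<^sub>R v\<close> the Lorentz form is \<open>e * (2 * (mirror p \<bullet> v) + e *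
  (mirror v \<bullet> v))\<close>. Were \<open>mirror p \<bullet> v\<close> positive for some
  \<open>v\<close> in the span, small \<open>e > 0\<close> would give a point of the span inside the
  cone. Applying this to \<open>v\<close> and \<open>- v\<close> gives equality.\<close>

lemma tangent_faceE:
  assumes C: "convex_cone C" and tan: "tangent_face (C \<inter> sphere 0 1)"
  obtains p where "p \<in> rel_interior C" "norm p = 1" "norm (snd p) = fst p"
    "\<And>v. v \<in> C \<Longrightarrow> mirror p \<bullet> v = 0"
proof -
  obtain p where p: "p \<in> rel_interior C" "p \<in> lorentz_cone" "p \<notin> interior lorentz_cone" "norm p = 1"
    using tan unfolding tangent_face_cone[OF C] is_singleton_def by fastforce
  have p0: "norm (snd p) = fst p"
    using p(2,3) interior_lorentz_coneI[of p] by (force simp: mem_lorentz_cone)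
  have "p \<noteq> 0" using p(4) by auto
  have pC: "p \<in> C" using p(1) rel_interior_subset by blast
  have tangent: "mirror p \<bullet> v \<le> 0" if v: "v \<in> span C" for v
  proof (rule ccontr)
    assume "\<not> ?thesis"
    then have m: "0 < mirror p \<bullet> v" by simp
    have fp: "0 < fst p" using p0 \<open>p \<noteq> 0\<close>
      by (metis norm_eq_zero norm_ge_zero order_le_less prod_eq_iff fst_zero snd_zero)
    have "((\<lambda>e. fst p + e * fst v) \<longlongrightarrow> fst p + 0 * fst v) (at_right 0)"
      by (intro tendsto_intros)
    then have e1: "\<forall>\<^sub>F e in at_right 0. 0 < fst p + e * fst v"
      using fp by (intro order_tendstoD) simp_all
    have "((\<lambda>e. 2 * (mirror p \<bullet> v) + e * (mirror v \<bullet> v)) \<longlongrightarrow> 2 * (mirror p \<bullet> v) + 0 * (mirror v \<bullet> v)) (at_right 0)"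
      by (intro tendsto_intros)
    then have e2: "\<forall>\<^sub>F e in at_right 0. 0 < 2 * (mirror p \<bullet> v) + e * (mirror v \<bullet> v)"
      by (rule order_tendstoD) (use m in simp)
    obtain e :: real where e: "0 < e" "0 < fst p + e * fst v"
      "0 < 2 * (mirror p \<bullet> v) + e * (mirror v \<bullet> v)"
      using eventually_happens'[OF _ eventually_conj[OF eventually_conj[OF e1 e2] eventually_at_right_less]]
      by auto
    define w where "w = p + e *\<^sub>R v"
    have "fst p * fst p = snd p \<bullet> snd p"
      using p0 by (metis power2_eq_square power2_norm_eq_inner)
    then have "(fst w)\<^sup>2 - (norm (snd w))\<^sup>2 = e * (2 * (mirror p \<bullet> v) + e * (mirror v \<bullet> v))"
      unfolding power2_norm_eq_inner w_def mirror_inner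
      by (simp add: inner_add_left inner_add_right inner_commute power2_eq_square algebra_simps)
    also have "\<dots> > 0" using e by simp
    finally have "norm (snd w) < fst w"
      using e(2) power2_less_imp_less[of "norm (snd w)" "fst w"] by (simp add: w_def)
    then have "w \<in> interior lorentz_cone" by (rule interior_lorentz_coneI)
    moreover have "w \<in> span C"
      using pC v by (simp add: w_def span_add span_base span_scale)
    ultimately show False using tan unfolding tangent_face_cone[OF C] by blast
  qed
  have "mirror p \<bullet> v = 0" if "v \<in> C" for v
    using tangent[of v] tangent[of "- v"] that by (simp add: span_base span_neg)
  with p p0 that show ?thesis by blast
qed

text \<open>Cones have one dimension more than their sections: the polytope gives
  \<open>CARD('d) + 1\<close>, and its ridges give \<open>CARD('d) - 1\<close>.\<close>

definition ridge_scribed_cone :: "'d::finite space set \<Rightarrow> bool" where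
  "ridge_scribed_cone K \<longleftrightarrow> pointed_cone K \<and> aff_dim K = int CARD('d) + 1 \<and>
     (\<forall>C. C face_of K \<longrightarrow> aff_dim C = int CARD('d) - 1 \<longrightarrow> tangent_face (C \<inter> sphere 0 1))"

lemma DIM_space: "DIM('d::finite space) = CARD('d) + 1"
  by simp

lemma ridge_scribed_coneD:
  fixes K :: "'d::finite space set"
  assumes "ridge_scribed_cone K"
  shows "pointed_cone K" "aff_dim K = int CARD('d) + 1"
    "\<And>C. C face_of K \<Longrightarrow> aff_dim C = int CARD('d) - 1 \<Longrightarrow> tangent_face (C \<inter> sphere 0 1)"
  using assms by (auto simp: ridge_scribed_cone_def)

text \<open>In dimension 1 the only ridge is the empty face, which is never tangent.\<close>

lemma ridge_scribed_cone_card: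
  fixes K :: "'d::finite space set"
  assumes K: "ridge_scribed_cone K"
  shows "2 \<le> int CARD('d)"
proof (rule ccontr)
  assume "\<not> ?thesis"
  then have "aff_dim {0 :: 'd space} = int CARD('d) - 1"
    using zero_less_card_finite[where 'a='d] by (simp add: not_le numeral_2_eq_2 less_Suc_eq)
  then have "tangent_face ({0 :: 'd space} \<inter> sphere 0 1)"
    using ridge_scribed_coneD[OF K] zero_face_of_pointed_cone by blast
  then show False
    using tangent_faceE[OF convex_cone_singleton] by fastforce
qed

context
  fixes K F :: "'d::finite space set"
  assumes K: "ridge_scribed_cone K" and F: "F facet_of K"
begin

lemma facet_ridge:
  assumes "R facet_of F"
  shows "R face_of K" "aff_dim R = int CARD('d) - 1" "R \<noteq> {}" "pointed_cone R"
proof -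
  show "R face_of K" using assms F face_of_trans facet_of_imp_face_of by blast
  moreover show "aff_dim R = int CARD('d) - 1" "R \<noteq> {}"
    using assms F ridge_scribed_coneD(2)[OF K] by (auto simp: facet_of_def)
  ultimately show "pointed_cone R" using ridge_scribed_coneD(1)[OF K] pointed_cone_face by blast
qed

lemma facet_cone: "pointed_cone F" "aff_dim F = int CARD('d)"
  using F ridge_scribed_coneD(1,2)[OF K] pointed_cone_face by (auto simp: facet_of_def)

lemma tangent_pointE:
  assumes "R facet_of F"
  obtains p where "p \<in> rel_interior R" "norm p = 1" "norm (snd p) = fst p"
    "\<And>v. v \<in> R \<Longrightarrow> mirror p \<bullet> v = 0"
  by (rule tangent_faceE[OF pointed_coneD(2)[OF facet_ridge(4)[OF assms]]
      ridge_scribed_coneD(3)[OF K facet_ridge(1,2)[OF assms]]]) (rule that)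

text \<open>Two ridges of a facet touch the light cone along different rays, so one of them lies strictly
  above the tangent hyperplane at the other.\<close>

lemma point_above_tangent:
  assumes "R face_of K" "p \<in> rel_interior R" "norm p = 1" "norm (snd p) = fst p"
  obtains p' where "p' \<in> F" "p' \<in> lorentz_cone" "0 < mirror p \<bullet> p'"
proof -
  have "2 \<le> aff_dim F" using facet_cone ridge_scribed_cone_card[OF K] by simp
  then obtain R' where R': "R' facet_of F" "R' \<noteq> R"
    using pointed_cone_second_facet[OF facet_cone(1)] by blast
  obtain p' where p': "p' \<in> rel_interior R'" "norm p' = 1" "norm (snd p') = fst p'"
    using tangent_pointE[OF R'(1)] by blast
  \<comment> \<open>Distinct faces have disjoint relative interiors.\<close>
  have "p' \<noteq> p"
    using face_of_eq[OF assms(1) facet_ridge(1)[OF R'(1)]] R'(2) p'(1) assms(2) by blast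
  moreover have "p' \<in> lorentz_cone" using p'(3) by (simp add: mem_lorentz_cone)
  moreover have "p' \<in> F"
    using p'(1) rel_interior_subset facet_of_imp_subset[OF R'(1)] by blast
  ultimately show ?thesis
    by (intro that[of p'] strict_support_lorentz_cone[OF assms(4,3) _ p'(2)])
qed

end

text \<open>The functional of the second facet through \<open>R\<close> is a combination \<open>\<alpha> a + \<beta> t\<close> of the functional
  \<open>a\<close> of \<open>F\<close> and the tangent functional \<open>t\<close> at \<open>R\<close>. Points of the light cone on the two facets
  force \<open>\<alpha> < 0 < \<beta>\<close>.\<close>

lemma tangent_hyperplane_supports:
  fixes K :: "'d::finite space set"
  assumes K: "ridge_scribed_cone K" and F: "F facet_of K"
    and a: "a \<noteq> 0" "\<And>x. x \<in> K \<Longrightarrow> 0 \<le> a \<bullet> x" "F = K \<inter> {x. a \<bullet> x = 0}"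
    and R: "R facet_of F"
    and p: "p \<in> rel_interior R" "norm p = 1" "norm (snd p) = fst p"
      "\<And>v. v \<in> R \<Longrightarrow> mirror p \<bullet> v = 0"
    and x: "x \<in> K"
  shows "0 \<le> mirror p \<bullet> x" "mirror p \<bullet> x = 0 \<Longrightarrow> a \<bullet> x = 0"
proof -
  note KP = ridge_scribed_coneD[OF K] and RR = facet_ridge[OF K F R]
  have RF: "R \<subseteq> F" using R facet_of_imp_subset by blast
  have "R \<noteq> F" using R by auto
  obtain p1 where p1: "p1 \<in> F" "0 < mirror p \<bullet> p1"
    using point_above_tangent[OF K F RR(1) p(1-3)] by blast
  \<comment> \<open>A proper face is the intersection of the facets containing it; with
    \<open>F\<close> alone this intersection would be \<open>F\<close>, not
    \<open>R\<close>.\<close>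
  have "\<exists>G. G facet_of K \<and> R \<subseteq> G \<and> G \<noteq> F"
  proof (rule ccontr)
    assume "\<not> ?thesis"
    then have "{G. G facet_of K \<and> R \<subseteq> G} = {F}" using F RF by blast
    moreover have "R \<noteq> K" using RF F \<open>R \<noteq> F\<close> facet_of_imp_subset[OF F] by auto
    then have "R = \<Inter>{G. G facet_of K \<and> R \<subseteq> G}"
      by (rule face_of_polyhedron[OF pointed_coneD(1)[OF KP(1)] RR(1,3)])
    ultimately show False using \<open>R \<noteq> F\<close> by simp
  qed
  then obtain G where G: "G facet_of K" "R \<subseteq> G" "G \<noteq> F" by blast
  obtain b where b: "b \<noteq> 0" "\<And>x. x \<in> K \<Longrightarrow> 0 \<le> b \<bullet> x" "G = K \<inter> {x. b \<bullet> x = 0}"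
    using pointed_cone_facetE[OF KP(1) G(1)] by blast
  obtain p2 where p2: "p2 \<in> G" "0 < mirror p \<bullet> p2"
    using point_above_tangent[OF K G(1) RR(1) p(1-3)] by blast
  have "int (dim R) = int CARD('d) - 1" using aff_dim_eq_dim_pointed[OF RR(4)] RR(2) by simp
  then have dimR: "dim R + 2 = DIM('d space)" unfolding DIM_space by linarith
  obtain \<alpha> \<beta> where ab: "b = \<alpha> *\<^sub>R a + \<beta> *\<^sub>R mirror p"
  proof (rule span_pair_of_codim2[OF dimR])
    show "a \<bullet> p1 = 0" "mirror p \<bullet> p1 \<noteq> 0" using p1 a(3) by auto
    show "a \<bullet> x = 0" "mirror p \<bullet> x = 0" "b \<bullet> x = 0" if "x \<in> R" for x
      using that RF G(2) a(3) b(3) p(4) by auto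
  qed (use a(1) in auto)
  have bx: "b \<bullet> x = \<alpha> * (a \<bullet> x) + \<beta> * (mirror p \<bullet> x)" for x
    by (simp add: ab inner_simps)
  have "0 \<le> \<beta> * (mirror p \<bullet> p1)" using b(2)[of p1] bx[of p1] p1(1) a(3) by simp
  then have "0 \<le> \<beta>" using p1(2) by (simp add: zero_le_mult_iff)
  moreover have "\<beta> \<noteq> 0"
  proof
    assume "\<beta> = 0"
    then have "b = \<alpha> *\<^sub>R a" using ab by simp
    then have "G = F" using b(1,3) a(3) by auto
    then show False using G(3) by simp
  qed
  ultimately have \<beta>: "0 < \<beta>" by simp
  have "\<alpha> * (a \<bullet> p2) + \<beta> * (mirror p \<bullet> p2) = 0" using bx[of p2] p2(1) b(3) by simp
  moreover have "0 < \<beta> * (mirror p \<bullet> p2)" using \<beta> p2(2) by simp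
  ultimately have "\<alpha> * (a \<bullet> p2) < 0" by simp
  moreover have "0 \<le> a \<bullet> p2" using p2(1) b(3) a(2) by auto
  ultimately have \<alpha>: "\<alpha> < 0" by (simp add: mult_less_0_iff)
  \<comment> \<open>Solved for the tangent functional, the relation exhibits it as a positive
    combination of two functionals that are nonnegative on \<open>K\<close>; where it vanishes, so
    does \<open>a\<close>.\<close>
  have eq: "\<beta> * (mirror p \<bullet> x) = b \<bullet> x + (- \<alpha>) * (a \<bullet> x)" using bx[of x] by simp
  have nn: "0 \<le> b \<bullet> x" "0 \<le> (- \<alpha>) * (a \<bullet> x)" using b(2) a(2) x \<alpha> by (simp_all add: mult_nonpos_nonneg)
  then have "0 \<le> \<beta> * (mirror p \<bullet> x)" using eq by simp
  then show "0 \<le> mirror p \<bullet> x" using \<beta> by (simp add: zero_le_mult_iff)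
  show "a \<bullet> x = 0" if "mirror p \<bullet> x = 0"
  proof -
    have "(- \<alpha>) * (a \<bullet> x) = 0" using eq nn that by simp
    then show ?thesis using \<alpha> by simp
  qed
qed

text \<open>The ridges of \<open>F\<close> belong to both cones, and the tangency point at such a
  ridge depends on the ridge alone. One tangent hyperplane therefore supports both cones and is a
  roof.\<close>

lemma glued_ridge_scribed_cones:
  fixes K1 K2 :: "'d::finite space set"
  assumes K1: "ridge_scribed_cone K1" and K2: "ridge_scribed_cone K2"
    and F1: "F facet_of K1" and F2: "F facet_of K2" and a0: "a \<noteq> 0"
    and a1: "\<And>x. x \<in> K1 \<Longrightarrow> 0 \<le> a \<bullet> x" "F = K1 \<inter> {x. a \<bullet> x = 0}"
    and a2: "\<And>x. x \<in> K2 \<Longrightarrow> a \<bullet> x \<le> 0" "F = K2 \<inter> {x. a \<bullet> x = 0}"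
  shows "glued_cones K1 K2 F a"
proof
  note Fc = facet_cone[OF K1 F1]
  show "pointed_cone K1" "pointed_cone K2" using K1 K2 ridge_scribed_coneD by auto
  show "F facet_of K1" "F facet_of K2" "\<And>x. x \<in> K1 \<Longrightarrow> 0 \<le> a \<bullet> x" "\<And>x. x \<in> K2 \<Longrightarrow> a \<bullet> x \<le> 0"
    "F = K1 \<inter> {x. a \<bullet> x = 0}" "F = K2 \<inter> {x. a \<bullet> x = 0}"
    by (fact F1 F2 a1 a2)+
  have "2 \<le> aff_dim F" using Fc ridge_scribed_cone_card[OF K1] by simp
  then show "\<exists>R. R facet_of F" using pointed_cone_second_facet[OF Fc(1)] by blast
  have roof: "roof K1 K2 a (mirror p)"
    if "R facet_of F" and p: "p \<in> rel_interior R" "norm p = 1" "norm (snd p) = fst p"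
      "\<And>v. v \<in> R \<Longrightarrow> mirror p \<bullet> v = 0" for R p
  proof -
    have "0 \<le> mirror p \<bullet> x \<and> (mirror p \<bullet> x = 0 \<longrightarrow> a \<bullet> x = 0)" if "x \<in> K1" for x
      using tangent_hyperplane_supports[OF K1 F1 a0 a1 \<open>R facet_of F\<close> p that] by blast
    moreover have "0 \<le> mirror p \<bullet> x \<and> (mirror p \<bullet> x = 0 \<longrightarrow> a \<bullet> x = 0)" if "x \<in> K2" for x
      \<comment> \<open>For the second cone the nonnegative functional of the facet \<open>F\<close>
        is \<open>- a\<close>.\<close>
      using tangent_hyperplane_supports[OF K2 F2, of "- a", OF _ _ _ \<open>R facet_of F\<close> p that] a0 a2 by simp
    ultimately show ?thesis by (auto simp: roof_def)
  qed
  show "\<exists>t. roof K1 K2 a t \<and> (\<forall>x\<in>R. t \<bullet> x = 0)" if R: "R facet_of F" for R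
  proof -
    obtain p where p: "p \<in> rel_interior R" "norm p = 1" "norm (snd p) = fst p"
      "\<And>v. v \<in> R \<Longrightarrow> mirror p \<bullet> v = 0"
      using tangent_pointE[OF K1 F1 R] by blast
    then show ?thesis using roof[OF R p] by blast
  qed
  fix x assume ax: "a \<bullet> x = 0" and t: "\<And>t. roof K1 K2 a t \<Longrightarrow> 0 \<le> t \<bullet> x"
  have "int (dim F) = int CARD('d)" using aff_dim_eq_dim_pointed[OF Fc(1)] Fc(2) by simp
  then have dimF: "dim F + 1 = DIM('d space)" unfolding DIM_space by linarith
  have aff: "x \<in> affine hull F"
    using affine_hull_codim1[OF Fc(1) dimF a0] a1(2) ax by blast
  \<comment> \<open>By minimality each half-space of this description cuts out a facet
    \<open>R\<close> of \<open>F\<close>, so it suffices to compare its normal with the tangent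
    functional at \<open>R\<close>.\<close>
  obtain \<H> where "finite \<H>" and seq: "F = affine hull F \<inter> \<Inter>\<H>"
    and "\<And>h. h \<in> \<H> \<Longrightarrow> \<exists>a b. a \<noteq> 0 \<and> h = {x. a \<bullet> x \<le> b}"
    and min: "\<And>F'. F' \<subset> \<H> \<Longrightarrow> F \<subset> (affine hull F) \<inter> \<Inter>F'"
    using pointed_coneD(1)[OF Fc(1)] by (simp add: polyhedron_Int_affine_minimal) meson
  then obtain c d where cd: "\<And>h. h \<in> \<H> \<Longrightarrow> c h \<noteq> 0 \<and> h = {x. c h \<bullet> x \<le> d h}" by metis
  have "x \<in> h" if h: "h \<in> \<H>" for h
  proof -
    define R where "R = F \<inter> {x. c h \<bullet> x = d h}"
    have R: "R facet_of F"
      using facet_of_polyhedron_explicit[OF \<open>finite \<H>\<close> seq cd min] h by (auto simp: R_def)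
    note RR = facet_ridge[OF K1 F1 R]
    have "d h = 0" using pointed_coneD(6)[OF RR(4)] by (simp add: R_def)
    obtain p where p: "p \<in> rel_interior R" "norm p = 1" "norm (snd p) = fst p"
      "\<And>v. v \<in> R \<Longrightarrow> mirror p \<bullet> v = 0"
      using tangent_pointE[OF K1 F1 R] by blast
    obtain p1 where p1: "p1 \<in> F" "0 < mirror p \<bullet> p1"
      using point_above_tangent[OF K1 F1 RR(1) p(1-3)] by blast
    have "int (dim R) = int CARD('d) - 1" using aff_dim_eq_dim_pointed[OF RR(4)] RR(2) by simp
    then have dimR: "dim R + 2 = DIM('d space)" unfolding DIM_space by linarith
    \<comment> \<open>On the hyperplane of \<open>a\<close> only the tangent term survives. Its sign
      is read off at \<open>p1\<close>, a point of \<open>F\<close> strictly above the tangent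
      hyperplane.\<close>
    obtain \<alpha> \<beta> where ab: "c h = \<alpha> *\<^sub>R a + \<beta> *\<^sub>R mirror p"
    proof (rule span_pair_of_codim2[OF dimR])
      show "a \<bullet> p1 = 0" "mirror p \<bullet> p1 \<noteq> 0" using p1 a1(2) by auto
      show "a \<bullet> x = 0" "mirror p \<bullet> x = 0" "c h \<bullet> x = 0" if "x \<in> R" for x
        using that p(4) a1(2) \<open>d h = 0\<close> by (auto simp: R_def)
    qed (use a0 in auto)
    have "p1 \<in> h" using p1(1) seq h by blast
    then have "c h \<bullet> p1 \<le> 0" using cd[OF h] \<open>d h = 0\<close> by auto
    then have "\<beta> * (mirror p \<bullet> p1) \<le> 0" using p1(1) a1(2) by (auto simp: ab inner_simps)
    then have "\<beta> \<le> 0" using p1(2) by (simp add: mult_le_0_iff)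
    then have "\<beta> * (mirror p \<bullet> x) \<le> 0" using t[OF roof[OF R p]] by (simp add: mult_nonpos_nonneg)
    then have "c h \<bullet> x \<le> d h" using ax \<open>d h = 0\<close> by (simp add: ab inner_simps)
    then show "x \<in> h" using cd[OF h] by auto
  qed
  then show "x \<in> F" using aff seq by blast
qed

section \<open>Moebius maps on cones\<close>

definition lorentz_map :: "('d::finite space \<Rightarrow> 'd space) \<Rightarrow> bool" where
  "lorentz_map L \<longleftrightarrow> linear L \<and> bij L \<and> L ` lorentz_cone = lorentz_cone"

lemma lorentz_mapD:
  assumes "lorentz_map L"
  shows "linear L" "bij L" "inj L" "surj L" "L ` lorentz_cone = lorentz_cone"
  using assms by (auto simp: lorentz_map_def bij_def)

lemma lorentz_map_inv:
  assumes "lorentz_map L"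
  shows "lorentz_map (inv L)"
proof -
  note L = lorentz_mapD[OF assms]
  obtain L' where "linear L'" "L' \<circ> L = id"
    using linear_injective_left_inverse[OF L(1,3)] by blast
  moreover from this(2) have "inv L = L'"
    using inv_unique_comp[of L L'] L(4) by (metis L(2) bij_is_inj inv_o_cancel comp_assoc comp_id id_comp surj_iff)
  moreover have "inv L ` lorentz_cone = lorentz_cone"
    using L(3,5) by (metis image_inv_f_f)
  ultimately show ?thesis
    using bij_imp_bij_inv[OF L(2)] by (simp add: lorentz_map_def)
qed

lemma lorentz_map_comp: "lorentz_map L \<Longrightarrow> lorentz_map M \<Longrightarrow> lorentz_map (L \<circ> M)"
  unfolding lorentz_map_def by (metis image_comp linear_compose bij_comp)

lemma inv_image_cancel:
  assumes "lorentz_map L"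
  shows "inv L ` L ` X = X" "L ` inv L ` X = X"
  using lorentz_mapD[OF assms] by (simp_all add: image_inv_f_f image_f_inv_f)

section \<open>Radial normalisation of linear maps\<close>

text \<open>The normalising factors are absorbed by the scaling of \<open>X\<close>. Only positive
  factors occur, so \<open>X\<close> may omit the origin, as the lightlike part of a relative
  interior can.\<close>

lemma sgn_linear_image_sphere:
  fixes L :: "'a::euclidean_space \<Rightarrow> 'a"
  assumes L: "linear L" "inj L" and X: "\<And>x c. x \<in> X \<Longrightarrow> 0 < c \<Longrightarrow> c *\<^sub>R x \<in> X"
  shows "(\<lambda>x. sgn (L x)) ` (X \<inter> sphere 0 1) = L ` X \<inter> sphere 0 1"
proof (intro set_eqI iffI)
  fix y assume "y \<in> (\<lambda>x. sgn (L x)) ` (X \<inter> sphere 0 1)"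
  then obtain x where x: "x \<in> X" "norm x = 1" "y = sgn (L x)" by auto
  have "x \<noteq> 0" using x(2) by auto
  then have Lx: "L x \<noteq> 0" using L by (metis linear_injective_0)
  then have "inverse (norm (L x)) *\<^sub>R x \<in> X" using X x(1) by simp
  then have "L (inverse (norm (L x)) *\<^sub>R x) \<in> L ` X" by blast
  then have "y \<in> L ` X" by (simp add: x(3) sgn_div_norm linear_cmul[OF L(1)])
  then show "y \<in> L ` X \<inter> sphere 0 1" using Lx by (simp add: x(3) norm_sgn)
next
  fix y assume "y \<in> L ` X \<inter> sphere 0 1"
  then obtain x where x: "x \<in> X" "y = L x" "norm (L x) = 1" by auto
  have "x \<noteq> 0" using x(3) linear_0[OF L(1)] by auto
  then have "inverse (norm x) *\<^sub>R x \<in> X \<inter> sphere 0 1" using X x(1) by simp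
  moreover have "sgn (L (inverse (norm x) *\<^sub>R x)) = y"
    using \<open>x \<noteq> 0\<close> x(2,3) by (simp add: linear_cmul[OF L(1)] sgn_scaleR sgn_div_norm)
  ultimately show "y \<in> (\<lambda>x. sgn (L x)) ` (X \<inter> sphere 0 1)" by (metis imageI)
qed

lemma inj_on_sgn_linear:
  fixes L :: "'a::euclidean_space \<Rightarrow> 'a"
  assumes L: "linear L" "inj L"
  shows "inj_on (\<lambda>x. sgn (L x)) (sphere 0 1)"
proof (rule inj_onI)
  fix x y assume xy: "x \<in> sphere 0 1" "y \<in> sphere 0 1" "sgn (L x) = sgn (L y)"
  then have "x \<noteq> 0" "y \<noteq> 0" by auto
  then have n: "0 < norm (L x)" "0 < norm (L y)" using L by (metis linear_injective_0 zero_less_norm_iff)+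
  have "L x = norm (L x) *\<^sub>R sgn (L y)" using n xy(3) by (metis norm_sgn sgn_div_norm scaleR_one scaleR_scaleR right_inverse less_irrefl)
  also have "\<dots> = L ((norm (L x) / norm (L y)) *\<^sub>R y)"
    by (simp add: linear_cmul[OF L(1)] sgn_div_norm divide_inverse)
  finally have "x = (norm (L x) / norm (L y)) *\<^sub>R y" using L(2) by (simp add: inj_def)
  moreover from this have "norm x = (norm (L x) / norm (L y)) * norm y"
    by (metis abs_of_pos divide_pos_pos n norm_scaleR)
  then have "norm (L x) / norm (L y) = 1"
    using xy(1,2) unfolding mem_sphere_0 by (simp only: mult_1_right)
  ultimately show "x = y" by (simp only: scaleR_one)
qed

lemma pointed_cone_linear_image:
  fixes L :: "'a::euclidean_space \<Rightarrow> 'a"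
  assumes "linear L" "bij L" "pointed_cone K"
  shows "pointed_cone (L ` K)"
proof -
  have inj: "inj L" using assms(2) by (rule bij_is_inj)
  have "y = 0" if y: "y \<in> L ` K" "- y \<in> L ` K" for y
  proof -
    obtain x x' where x: "x \<in> K" "y = L x" "x' \<in> K" "- y = L x'" using y by (metis imageE)
    then have "L x' = L (- x)" using linear_neg[OF assms(1)] by simp
    then have "- x \<in> K" using inj x by (simp add: inj_eq)
    then show ?thesis using pointed_coneD(8)[OF assms(3)] x linear_0[OF assms(1)] by metis
  qed
  moreover have "polyhedron (L ` K)"
    using polyhedron_linear_image_eq[OF assms(1,2)] pointed_coneD(1)[OF assms(3)] by simp
  moreover have "convex_cone (L ` K)"
    using convex_cone_linear_image[of K L] pointed_coneD(2)[OF assms(3)] assms(1) by simp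
  ultimately show ?thesis unfolding pointed_cone_def by simp
qed

text \<open>\<open>L\<close> carries the cone, its interior and relative interiors onto their
  counterparts. The new tangency point is the normalised image of the old one.\<close>

lemma tangent_face_lorentz_map:
  assumes L: "lorentz_map L" and C: "convex_cone C" and tan: "tangent_face (C \<inter> sphere 0 1)"
  shows "tangent_face (L ` C \<inter> sphere 0 1)"
proof -
  note L' = lorentz_mapD[OF L]
  define X where "X = rel_interior C \<inter> (lorentz_cone - interior lorentz_cone)"
  have Lint: "L ` interior lorentz_cone = interior lorentz_cone"
    using interior_injective_linear_image[OF L'(1,3), of lorentz_cone] L'(5) by simp
  have LX: "rel_interior (L ` C) \<inter> (lorentz_cone - interior lorentz_cone) = L ` X"
    unfolding X_def image_Int[OF L'(3)] image_set_diff[OF L'(3)] Lint L'(5)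
    using rel_interior_injective_linear_image[of L C] L'(1,3) by (simp add: linear_conv_bounded_linear)
  have "c *\<^sub>R x \<in> X" if x: "x \<in> X" and c: "0 < c" for x c
  proof -
    have cC: "(*\<^sub>R) c ` C = C"
    proof
      show "(*\<^sub>R) c ` C \<subseteq> C" using convex_cone_scaleR[OF C] c by auto
      show "C \<subseteq> (*\<^sub>R) c ` C"
      proof
        fix y assume "y \<in> C"
        then have "inverse c *\<^sub>R y \<in> C" using convex_cone_scaleR[OF C] c by simp
        then have "c *\<^sub>R (inverse c *\<^sub>R y) \<in> (*\<^sub>R) c ` C" by blast
        then show "y \<in> (*\<^sub>R) c ` C" using c by simp
      qed
    qed
    have "c *\<^sub>R x \<in> rel_interior C"
      using rel_interior_scaleR[of c C] cC x c by (auto simp: X_def)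
    moreover have "c *\<^sub>R x \<in> interior lorentz_cone \<Longrightarrow> x \<in> interior lorentz_cone"
      using interior_lorentz_cone_scale[of "c *\<^sub>R x" "inverse c"] c by simp
    ultimately show ?thesis using x c lorentz_cone_scale[of x c] by (auto simp: X_def)
  qed
  then have "(\<lambda>x. sgn (L x)) ` (X \<inter> sphere 0 1) = L ` X \<inter> sphere 0 1"
    by (rule sgn_linear_image_sphere[OF L'(1,3)])
  moreover have "is_singleton (X \<inter> sphere 0 1)"
    using tan unfolding tangent_face_cone[OF C] X_def by blast
  ultimately have "is_singleton (L ` X \<inter> sphere 0 1)"
    by (metis image_empty image_insert is_singleton_def)
  moreover have "span (L ` C) \<inter> interior lorentz_cone = L ` (span C \<inter> interior lorentz_cone)"
    using linear_span_image[OF L'(1), of C] image_Int[OF L'(3)] Lint by metis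
  moreover have "convex_cone (L ` C)" using C L'(1) convex_cone_linear_image by blast
  ultimately show ?thesis
    using tan unfolding tangent_face_cone[OF C] by (simp add: tangent_face_cone LX)
qed

lemma ridge_scribed_cone_lorentz_map:
  assumes L: "lorentz_map L" and K: "ridge_scribed_cone K"
  shows "ridge_scribed_cone (L ` K)"
  unfolding ridge_scribed_cone_def
proof (intro conjI allI impI)
  note L' = lorentz_mapD[OF L] and K' = ridge_scribed_coneD[OF K]
  show "pointed_cone (L ` K)" by (rule pointed_cone_linear_image[OF L'(1,2) K'(1)])
  show "aff_dim (L ` K) = int CARD('a) + 1" 
    using K'(2) aff_dim_injective_linear_image[OF L'(1,3), of K] by simp
  fix D assume D: "D face_of L ` K" "aff_dim D = int CARD('a) - 1"
  have "D \<in> {D. D face_of L ` K}" using D(1) by simp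
  then have "D \<in> (`) L ` {C. C face_of K}" unfolding faces_of_linear_image[OF L'(1,3)] .
  then obtain C where C: "C face_of K" "D = L ` C" by blast
  have dim: "aff_dim C = int CARD('a) - 1" 
    using C(2) D(2) aff_dim_injective_linear_image[OF L'(1,3), of C] by simp
  have "C \<noteq> {}" using dim by auto
  then show "tangent_face (D \<inter> sphere 0 1)"
    unfolding C(2)
    by (rule tangent_face_lorentz_map[OF L convex_cone_face[OF K'(1) C(1)] K'(3)[OF C(1) dim]])
qed

section \<open>Lorentz reflections in facet hyperplanes\<close>

text \<open>The sum of two vectors of the light cone is timelike as soon as their Lorentz product is
  positive; a tangency point and a point of the facet above its tangent hyperplane provide such a
  pair.\<close>

lemma ridge_scribed_facet_timelike:
  fixes K :: "'d::finite space set"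
  assumes "ridge_scribed_cone K" "F facet_of K"
  obtains z where "z \<in> F" "norm (snd z) < fst z"
proof -
  have "2 \<le> aff_dim F"
    using facet_cone[OF assms] ridge_scribed_cone_card[OF assms(1)] by simp
  then obtain R where R: "R facet_of F"
    using pointed_cone_second_facet[OF facet_cone(1)[OF assms]] by blast
  obtain p where p: "p \<in> rel_interior R" "norm p = 1" "norm (snd p) = fst p"
    using tangent_pointE[OF assms R] by blast
  obtain q where q: "q \<in> F" "q \<in> lorentz_cone" "0 < mirror p \<bullet> q"
    by (rule point_above_tangent[OF assms facet_ridge(1)[OF assms R] p])
  have pl: "p \<in> lorentz_cone" using p by (simp add: mem_lorentz_cone)
  have pF: "p \<in> F" using p(1) R rel_interior_subset facet_of_imp_subset by blast
  have "0 \<le> mirror p \<bullet> p" "0 \<le> mirror q \<bullet> q" "0 \<le> fst p" "0 \<le> fst q"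
    using pl q(2) by (auto simp: mem_lorentz_cone_form)
  moreover have "mirror (p + q) = mirror p + mirror q" by (simp add: mirror_def)
  moreover have "mirror q \<bullet> p = mirror p \<bullet> q" by (metis mirror_sym inner_commute)
  ultimately have "0 < mirror (p + q) \<bullet> (p + q)" "0 \<le> fst (p + q)"
    using q(3) by (simp_all add: inner_add_left inner_add_right)
  then have "(norm (snd (p + q)))\<^sup>2 < (fst (p + q))\<^sup>2"
    unfolding power2_norm_eq_inner mirror_inner by (simp add: power2_eq_square)
  then have "norm (snd (p + q)) < fst (p + q)"
    using \<open>0 \<le> fst (p + q)\<close> by (rule power2_less_imp_less)
  moreover have "p + q \<in> F"
    using convex_cone_add[OF pointed_coneD(2)[OF facet_cone(1)[OF assms]] pF q(1)] .
  ultimately show ?thesis by (intro that)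
qed

text \<open>\<open>mirror a\<close> is the Lorentz normal of the hyperplane with Euclidean normal
  \<open>a\<close>, and the form takes the same value on both. So a hyperplane through a timelike
  vector has a spacelike normal.\<close>

lemma orthogonal_timelike_spacelike:
  assumes z: "norm (snd z) < fst z" and a: "a \<noteq> 0" "a \<bullet> z = 0"
  shows "mirror a \<bullet> a < 0"
proof -
  have "\<bar>fst a\<bar> < norm (snd a)"
  proof (cases "snd a = 0")
    case True
    have "0 < fst z" using z norm_ge_zero[of "snd z"] by linarith
    then show ?thesis using a True by (auto simp: inner_prod_def prod_eq_iff)
  next
    case False
    have z0: "0 < fst z" using z norm_ge_zero[of "snd z"] by linarith
    have "fst a * fst z = - (snd a \<bullet> snd z)" using a(2) by (simp add: inner_prod_def)
    then have "\<bar>fst a\<bar> * fst z = \<bar>snd a \<bullet> snd z\<bar>"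
      using z0 by (metis abs_minus_cancel abs_mult abs_of_pos)
    also have "\<dots> \<le> norm (snd a) * norm (snd z)" by (rule Cauchy_Schwarz_ineq2)
    also have "\<dots> < norm (snd a) * fst z" using z False by simp
    finally show ?thesis using z0 by simp
  qed
  then have "(fst a)\<^sup>2 < (norm (snd a))\<^sup>2"
    using power_strict_mono[of "\<bar>fst a\<bar>" "norm (snd a)" 2] by simp
  then show ?thesis
    unfolding power2_norm_eq_inner mirror_inner by (simp add: power2_eq_square)
qed

text \<open>Time orientation is read off from the product with a timelike vector. A map that
  preserves the form and all products with \<open>z\<close> thus cannot exchange future and
  past.\<close>

lemma future_iff:
  assumes z: "norm (snd z) < fst z" and x: "0 \<le> mirror x \<bullet> x"
  shows "0 \<le> fst x \<longleftrightarrow> 0 \<le> mirror z \<bullet> x"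
proof
  assume "0 \<le> fst x"
  then show "0 \<le> mirror z \<bullet> x"
    using support_lorentz_cone[of z x] z x mem_lorentz_cone[of z] mem_lorentz_cone_form[of x] by simp
next
  have z0: "0 < fst z" using z norm_ge_zero[of "snd z"] by linarith
  assume m: "0 \<le> mirror z \<bullet> x"
  show "0 \<le> fst x"
  proof (rule ccontr)
    assume "\<not> ?thesis"
    then have neg: "0 < - fst x" by simp
    have "(norm (snd x))\<^sup>2 \<le> (- fst x)\<^sup>2"
      using x unfolding power2_norm_eq_inner mirror_inner by (simp add: power2_eq_square)
    then have le: "norm (snd x) \<le> - fst x" by (rule power2_le_imp_le) (use neg in simp)
    have "- (snd z \<bullet> snd x) \<le> norm (snd z) * norm (snd x)"
      using Cauchy_Schwarz_ineq2[of "snd z" "snd x"] by linarith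
    also have "\<dots> \<le> norm (snd z) * (- fst x)" by (rule mult_left_mono[OF le norm_ge_zero])
    also have "\<dots> < fst z * (- fst x)" using z neg by (rule mult_strict_right_mono)
    finally show False using m by (simp add: mirror_inner)
  qed
qed

text \<open>The usual reflection for the Lorentz form in the hyperplane
  \<open>a \<bullet> x = 0\<close>: its Lorentz normal is \<open>mirror a\<close>, whose product
  with \<open>x\<close> is \<open>a \<bullet> x\<close>.\<close>

definition reflection :: "'d::finite space \<Rightarrow> 'd space \<Rightarrow> 'd space" where
  "reflection a x = x - (2 * (a \<bullet> x) / (mirror a \<bullet> a)) *\<^sub>R mirror a"

lemma reflection_inner:
  assumes "mirror a \<bullet> a \<noteq> 0"
  shows "a \<bullet> reflection a x = - (a \<bullet> x)"
proof -
  have "a \<bullet> mirror a = mirror a \<bullet> a" by (simp add: inner_commute)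
  then show ?thesis using assms by (simp add: reflection_def inner_diff_right)
qed

text \<open>The reflection preserves the form, and it preserves products with \<open>z\<close>
  because \<open>z\<close> lies in the mirror hyperplane; \<open>future_iff\<close> then keeps the
  future cone in place. Being an involution makes it bijective and the inclusion of cones an
  equality.\<close>

lemma reflection_lorentz_map:
  assumes z: "norm (snd z) < fst z" and a: "a \<noteq> 0" "a \<bullet> z = 0"
  shows "lorentz_map (reflection a)"
proof -
  define s where "s = mirror a \<bullet> a"
  have s: "s \<noteq> 0" using orthogonal_timelike_spacelike[OF assms] by (simp add: s_def)
  let ?r = "reflection a"
  have invol: "?r (?r x) = x" for x
    using reflection_inner[of a x] s unfolding reflection_def[of a "reflection a x"]
    by (simp add: s_def) (simp add: reflection_def)
  then have bij: "bij ?r" by (metis bij_betw_def inj_on_inverseI surjI)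
  have lin: "linear ?r"
    unfolding reflection_def
    by (intro linearI) (simp_all add: inner_simps algebra_simps add_divide_distrib)
  have sub: "?r x \<in> lorentz_cone" if x: "x \<in> lorentz_cone" for x
  proof -
    define c where "c = 2 * (a \<bullet> x) / s"
    have r: "?r x = x - c *\<^sub>R mirror a" by (simp add: reflection_def c_def s_def)
    have mirror_diff: "mirror (u - c *\<^sub>R v) = mirror u - c *\<^sub>R mirror v" for u v :: "'a space" and c
      by (simp add: mirror_def)
    have "mirror (?r x) \<bullet> ?r x = (mirror x - c *\<^sub>R a) \<bullet> (x - c *\<^sub>R mirror a)"
      unfolding r mirror_diff by simp
    also have "\<dots> = mirror x \<bullet> x - c * (mirror x \<bullet> mirror a) - c * (a \<bullet> x) + c * c * (a \<bullet> mirror a)"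
      by (simp add: inner_diff_left inner_diff_right algebra_simps)
    also have "mirror x \<bullet> mirror a = a \<bullet> x" by (metis mirror_sym mirror_mirror inner_commute)
    also have "a \<bullet> mirror a = s" by (simp add: s_def inner_commute)
    also have "c * c * s = 2 * (c * (a \<bullet> x))" using s by (simp add: c_def)
    finally have form: "mirror (?r x) \<bullet> ?r x = mirror x \<bullet> x" by simp
    have "mirror z \<bullet> mirror a = a \<bullet> z" by (metis mirror_sym mirror_mirror inner_commute)
    then have "mirror z \<bullet> ?r x = mirror z \<bullet> x"
      unfolding r by (simp add: inner_diff_right a(2))
    then show ?thesis
      using x future_iff[OF z, of x] future_iff[OF z, of "?r x"] form
      by (simp add: mem_lorentz_cone_form)
  qed
  have "x \<in> ?r ` lorentz_cone" if "x \<in> lorentz_cone" for x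
    using sub[OF that] invol[of x] by (metis imageI)
  then have "?r ` lorentz_cone = lorentz_cone" using sub by (intro equalityI subsetI) auto
  then show ?thesis using bij lin by (simp add: lorentz_map_def)
qed

section \<open>Spherical polytopes as cones\<close>

lemma spherical_polytope_cone:
  assumes "spherical_polytope P"
  shows "pointed_cone (convex_cone hull P)" "P = convex_cone hull P \<inter> sphere 0 1"
proof -
  obtain N where N: "finite N" "P = {x \<in> sphere 0 1. \<forall>a\<in>N. 0 \<le> a \<bullet> x}"
    and anti: "\<And>x. x \<in> P \<Longrightarrow> - x \<notin> P"
    using assms unfolding spherical_polytope_def by blast
  define K where "K = \<Inter>((\<lambda>a. {x. a \<bullet> x \<ge> 0}) ` N)"
  have P: "P = K \<inter> sphere 0 1" using N(2) by (auto simp: K_def)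
  have cone: "convex_cone K"
    unfolding K_def by (rule convex_cone_Inter) (auto simp: convex_cone_halfspace_ge)
  have "polyhedron K"
    unfolding K_def using N(1) by (intro polyhedron_Inter) (auto simp: polyhedron_halfspace_ge)
  moreover have "x = 0" if "x \<in> K" "- x \<in> K" for x
  proof (rule ccontr)
    assume "x \<noteq> 0"
    then have "inverse (norm x) *\<^sub>R x \<in> P" "inverse (norm x) *\<^sub>R (- x) \<in> P"
      using convex_cone_scaleR[OF cone _ that(1)] convex_cone_scaleR[OF cone _ that(2)]
      unfolding P by (auto simp del: scaleR_minus_right)
    then show False using anti[of "inverse (norm x) *\<^sub>R x"] by simp
  qed
  ultimately have "pointed_cone K" using cone by (simp add: pointed_cone_def)
  moreover have "convex_cone hull P = K" unfolding P using convex_cone_hull_sphere[OF cone] .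
  ultimately show "pointed_cone (convex_cone hull P)" "P = convex_cone hull P \<inter> sphere 0 1"
    using P by simp_all
qed

text \<open>The affine half-spaces cutting out a cone may be replaced by linear ones: boundedness
  along a ray makes each functional nonpositive on \<open>K\<close>, and membership of 0 makes each
  offset nonnegative.\<close>

lemma pointed_cone_spherical_polytope:
  assumes K: "pointed_cone K"
  shows "spherical_polytope (K \<inter> sphere 0 1)"
proof -
  obtain \<H> where \<H>: "finite \<H>" "K = \<Inter>\<H>"
    "\<And>h. h \<in> \<H> \<Longrightarrow> \<exists>a b. a \<noteq> 0 \<and> h = {x. a \<bullet> x \<le> b}"
    using pointed_coneD(1)[OF K] unfolding polyhedron_def by metis
  then obtain a b where "\<And>h. h \<in> \<H> \<Longrightarrow> a h \<noteq> 0 \<and> h = {x. a h \<bullet> x \<le> b h}" by metis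
  then have a: "a h \<noteq> 0" and mem: "x \<in> h \<longleftrightarrow> a h \<bullet> x \<le> b h" if "h \<in> \<H>" for h x
    using that by blast+
  have nonpos: "a h \<bullet> x \<le> 0" if h: "h \<in> \<H>" and x: "x \<in> K" for h x
  proof (rule ccontr)
    assume "\<not> ?thesis"
    then have pos: "0 < a h \<bullet> x" by simp
    have "c * (a h \<bullet> x) \<le> b h" if "0 \<le> c" for c
    proof -
      have "c *\<^sub>R x \<in> h" using pointed_cone_scale[OF K that x] \<H>(2) h by blast
      then show ?thesis using mem[OF h] by simp
    qed
    \<comment> \<open>This multiple of \<open>x\<close> takes the functional to the value
      \<open>\<bar>b h\<bar> + 1\<close>, beyond the offset.\<close>
    from this[of "(\<bar>b h\<bar> + 1) / (a h \<bullet> x)"] show False using pos by simp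
  qed
  have b0: "0 \<le> b h" if "h \<in> \<H>" for h
  proof -
    have "0 \<in> h" using pointed_coneD(6)[OF K] \<H>(2) that by blast
    then show ?thesis using mem[OF that] by simp
  qed
  define N where "N = (\<lambda>h. - a h) ` \<H>"
  have "K = {x. \<forall>n\<in>N. 0 \<le> n \<bullet> x}"
  proof (intro set_eqI iffI)
    show "x \<in> {x. \<forall>n\<in>N. 0 \<le> n \<bullet> x}" if "x \<in> K" for x
      using nonpos that by (auto simp: N_def)
    show "x \<in> K" if x: "x \<in> {x. \<forall>n\<in>N. 0 \<le> n \<bullet> x}" for x
    proof -
      have "x \<in> h" if h: "h \<in> \<H>" for h
      proof -
        have "a h \<bullet> x \<le> 0" using x h by (auto simp: N_def)
        then show ?thesis using b0[OF h] mem[OF h] by simp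
      qed
      then show ?thesis using \<H>(2) by blast
    qed
  qed
  then have "K \<inter> sphere 0 1 = {x \<in> sphere 0 1. \<forall>n\<in>N. 0 \<le> n \<bullet> x}" by blast
  moreover have "finite N" "0 \<notin> N" using \<H>(1) a by (auto simp: N_def)
  moreover have "- x \<notin> K \<inter> sphere 0 1" if "x \<in> K \<inter> sphere 0 1" for x
    using that pointed_coneD(8)[OF K, of x] by auto
  ultimately show ?thesis unfolding spherical_polytope_def by blast
qed

lemma ridge_scribed_iff_cone:
  fixes K :: "'d::finite space set"
  assumes "pointed_cone K"
  shows "ridge_scribed (K \<inter> sphere 0 1) \<longleftrightarrow> ridge_scribed_cone K"
proof -
  have hull: "convex_cone hull (K \<inter> sphere 0 1) = K"
    by (rule convex_cone_hull_sphere[OF pointed_coneD(2)[OF assms]])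
  have "d_polytope (K \<inter> sphere 0 1) \<longleftrightarrow> aff_dim K = int CARD('d) + 1"
    using pointed_cone_spherical_polytope[OF assms]
    unfolding d_polytope_def spherical_dim_def hull by auto
  moreover have "(\<forall>G\<in>ridges (K \<inter> sphere 0 1). tangent_face G) \<longleftrightarrow>
      (\<forall>C. C face_of K \<longrightarrow> aff_dim C = int CARD('d) - 1 \<longrightarrow> tangent_face (C \<inter> sphere 0 1))"
  proof -
    have "int CARD('d) - 2 + 1 = int CARD('d) - 1" by simp
    then show ?thesis unfolding ridges_def spherical_k_faces_def hull by (simp only:) blast
  qed
  ultimately show ?thesis
    unfolding ridge_scribed_def ridge_scribed_cone_def by (simp only: assms simp_thms)
qed

text \<open>The cone faces \<open>{}\<close> and \<open>{0}\<close> both give the empty spherical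
  face. Dropping \<open>{}\<close> leaves convex cones, which are determined by their
  sections.\<close>

lemma spherical_faces_cone:
  fixes K :: "'d::finite space set"
  assumes K: "pointed_cone K"
  shows "spherical_faces (K \<inter> sphere 0 1) = (\<lambda>C. C \<inter> sphere 0 1) ` {C. C face_of K \<and> C \<noteq> {}}"
proof -
  have "{0 :: 'd space} \<inter> sphere 0 1 \<in> (\<lambda>C. C \<inter> sphere 0 1) ` {C. C face_of K \<and> C \<noteq> {}}"
    using zero_face_of_pointed_cone[OF K] by (intro imageI) simp
  moreover have "{0 :: 'd space} \<inter> sphere 0 1 = {}" by simp
  ultimately have "C \<inter> sphere 0 1 \<in> (\<lambda>C. C \<inter> sphere 0 1) ` {C. C face_of K \<and> C \<noteq> {}}" if "C face_of K" for C
    using that by (cases "C = {}") auto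
  then show ?thesis
    unfolding spherical_faces_def convex_cone_hull_sphere[OF pointed_coneD(2)[OF K]] by blast
qed

lemma sphere_section_mono_iff:
  fixes C D :: "'a::euclidean_space set"
  assumes "convex_cone C" "convex_cone D"
  shows "C \<inter> sphere 0 1 \<subseteq> D \<inter> sphere 0 1 \<longleftrightarrow> C \<subseteq> D"
proof
  assume "C \<inter> sphere 0 1 \<subseteq> D \<inter> sphere 0 1"
  then have "convex_cone hull (C \<inter> sphere 0 1) \<subseteq> convex_cone hull (D \<inter> sphere 0 1)"
    by (rule hull_mono)
  then show "C \<subseteq> D" by (simp add: convex_cone_hull_sphere assms)
qed blast

lemma sphere_section_eq_iff:
  fixes C D :: "'a::euclidean_space set"
  assumes "convex_cone C" "convex_cone D"
  shows "C \<inter> sphere 0 1 = D \<inter> sphere 0 1 \<longleftrightarrow> C = D"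
  using sphere_section_mono_iff[OF assms] sphere_section_mono_iff[OF assms(2,1)]
  by (simp only: set_eq_subset)

lemma bij_betw_spherical_faces:
  fixes L :: "'d::finite space \<Rightarrow> 'd space"
  assumes L: "linear L" "bij L" and K: "pointed_cone K"
  shows "bij_betw ((`) (\<lambda>x. sgn (L x))) (spherical_faces (K \<inter> sphere 0 1))
           (spherical_faces (L ` K \<inter> sphere 0 1))"
    (is "bij_betw ?f _ _")
proof -
  have inj: "inj L" using L(2) by (rule bij_is_inj)
  have im: "?f (C \<inter> sphere 0 1) = L ` C \<inter> sphere 0 1" if "C face_of K" "C \<noteq> {}" for C
    by (rule sgn_linear_image_sphere[OF L(1) inj])
      (rule convex_cone_scaleR[OF convex_cone_face[OF K that]], simp_all)
  have "{D. D face_of L ` K \<and> D \<noteq> {}} = {D. D face_of L ` K} - {{}}" by blast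
  also have "\<dots> = (`) L ` {C. C face_of K} - {{}}"
    using faces_of_linear_image[OF L(1) inj, of K] by simp
  also have "\<dots> = (`) L ` {C. C face_of K \<and> C \<noteq> {}}" by auto
  finally have "spherical_faces (L ` K \<inter> sphere 0 1) =
      (\<lambda>C. L ` C \<inter> sphere 0 1) ` {C. C face_of K \<and> C \<noteq> {}}"
    unfolding spherical_faces_cone[OF pointed_cone_linear_image[OF L K]] by (simp add: image_image)
  also have "\<dots> = (\<lambda>C. ?f (C \<inter> sphere 0 1)) ` {C. C face_of K \<and> C \<noteq> {}}"
    by (rule image_cong[OF refl]) (use im in simp)
  finally have "?f ` spherical_faces (K \<inter> sphere 0 1) = spherical_faces (L ` K \<inter> sphere 0 1)"
    unfolding spherical_faces_cone[OF K] by (simp only: image_image)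
  moreover have "spherical_faces (K \<inter> sphere 0 1) \<subseteq> Pow (sphere 0 1)"
    by (auto simp: spherical_faces_def)
  then have "inj_on ?f (spherical_faces (K \<inter> sphere 0 1))"
    using inj_on_image_Pow[OF inj_on_sgn_linear[OF L(1) inj]] by (rule inj_on_subset[rotated])
  ultimately show ?thesis by (intro bij_betw_imageI)
qed

section \<open>The face lattice of the glued polytope\<close>

lemma Field_adjoin_top: "Field (adjoin_top r) = insert None (Some ` Field r)"
  by (force simp: adjoin_top_def Field_def)

text \<open>\<open>BP\<close> and \<open>BQ\<close> are the proper faces that the two polytopes contribute to \<open>R\<close>; the
  identification class of a face of \<open>R\<close> consists of its copies in \<open>P\<close> and in \<open>Q\<close>.\<close>

lemma order_isomorphic_connected_sum:
  fixes R P Q F :: "'d::finite space set"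
    and \<phi> \<psi> :: "'d space set \<Rightarrow> 'd space set"
  assumes faces: "spherical_faces R = insert R (BP \<union> BQ)" "R \<notin> BP \<union> BQ"
    "\<And>A. A \<in> BP \<union> BQ \<Longrightarrow> A \<subseteq> R"
    and common: "BP \<inter> BQ = boundary_complex F"
    and mixed: "\<And>A B. A \<in> BP \<Longrightarrow> B \<in> BQ \<Longrightarrow> A \<subseteq> B \<Longrightarrow> A \<in> BQ"
      "\<And>A B. A \<in> BP \<Longrightarrow> B \<in> BQ \<Longrightarrow> B \<subseteq> A \<Longrightarrow> B \<in> BP"
    and \<phi>: "inj_on \<phi> BP" "\<phi> ` BP = boundary_complex P - {f ` F}"
      "\<And>A B. A \<in> BP \<Longrightarrow> B \<in> BP \<Longrightarrow> \<phi> A \<subseteq> \<phi> B \<longleftrightarrow> A \<subseteq> B"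
    and \<psi>: "inj_on \<psi> BQ" "\<psi> ` BQ = boundary_complex Q - {g ` F}"
      "\<And>A B. A \<in> BQ \<Longrightarrow> B \<in> BQ \<Longrightarrow> \<psi> A \<subseteq> \<psi> B \<longleftrightarrow> A \<subseteq> B"
    and fg: "\<And>A. A \<in> boundary_complex F \<Longrightarrow> f ` A = \<phi> A \<and> g ` A = \<psi> A"
  shows "order_isomorphic (face_lattice R) (connected_sum P Q F f g)"
proof -
  let ?B = "BP \<union> BQ"
  let ?E = "sum_identification F f g"
  define glue :: "'d space set + 'd space set \<Rightarrow> 'd space set + 'd space set \<Rightarrow> bool" where
    "glue = (\<lambda>x y. \<exists>A\<in>BP \<inter> BQ. x = Inl (\<phi> A) \<and> y = Inr (\<psi> A))"
  have E: "(x, y) \<in> ?E \<longleftrightarrow> equivclp glue x y" for x y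
  proof -
    have "(\<lambda>x y. \<exists>A\<in>boundary_complex F. x = Inl (f ` A) \<and> y = Inr (g ` A)) = glue"
      unfolding glue_def common using fg by (intro ext bex_cong) auto
    then show ?thesis by (simp add: sum_identification_def)
  qed
  define T :: "'d space set \<Rightarrow> ('d space set + 'd space set) set" where
    "T = (\<lambda>A. {x. (A \<in> BP \<and> x = Inl (\<phi> A)) \<or> (A \<in> BQ \<and> x = Inr (\<psi> A))})"
  have T_cases: "(A \<in> BP \<and> z = Inl (\<phi> A)) \<or> (A \<in> BQ \<and> z = Inr (\<psi> A))" if "z \<in> T A" for z A
    using that by (simp add: T_def)
  \<comment> \<open>Injectivity of \<open>\<phi>\<close> and \<open>\<psi>\<close> lets a glued pair
    meet only the set \<open>T C\<close> of the face \<open>C\<close> it comes from, so every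
    \<open>T A\<close> is closed under the identification.\<close>
  have T_glue: "x \<in> T A \<longleftrightarrow> y \<in> T A" if xy: "glue x y" for A x y
  proof -
    obtain C where C: "C \<in> BP" "C \<in> BQ" "x = Inl (\<phi> C)" "y = Inr (\<psi> C)"
      using xy by (auto simp: glue_def)
    have "x \<in> T A \<longleftrightarrow> A = C" using C inj_on_eq_iff[OF \<phi>(1)] by (auto simp: T_def)
    moreover have "y \<in> T A \<longleftrightarrow> A = C" using C inj_on_eq_iff[OF \<psi>(1)] by (auto simp: T_def)
    ultimately show ?thesis by simp
  qed
  have T_closed: "y \<in> T A" if "equivclp glue x y" "x \<in> T A" for A x y
    using that by (induction rule: equivclp_induct) (use T_glue in blast)+
  have T_class: "?E `` {x} = T A" if "x \<in> T A" for A x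
  proof (intro set_eqI iffI)
    fix y assume "y \<in> ?E `` {x}"
    then show "y \<in> T A" using T_closed[OF _ that] E by blast
  next
    fix y assume y: "y \<in> T A"
    have both: "glue (Inl (\<phi> A)) (Inr (\<psi> A))" if "A \<in> BP" "A \<in> BQ"
      unfolding glue_def using that by blast
    have "x = y \<or> glue x y \<or> glue y x"
      using T_cases[OF \<open>x \<in> T A\<close>] T_cases[OF y] by (elim disjE conjE) (simp_all add: both)
    then have "equivclp glue x y"
      by (elim disjE) (simp, erule r_into_equivclp, erule converse_r_into_equivclp)
    then show "y \<in> ?E `` {x}" using E by simp
  qed
  have T_inj: "A = B" if "x \<in> T A" "x \<in> T B" for A B x
    using T_cases[OF that(1)] T_cases[OF that(2)]
    by (elim disjE conjE) (simp_all add: inj_on_eq_iff[OF \<phi>(1)] inj_on_eq_iff[OF \<psi>(1)])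
  have T_nonempty: "\<exists>x. x \<in> T A" if "A \<in> ?B" for A
    using that by (auto simp: T_def)
  have cells: "sum_cells P Q F f g = Inl ` \<phi> ` BP \<union> Inr ` \<psi> ` BQ"
    unfolding sum_cells_def \<phi>(2) \<psi>(2) ..
  have quot: "sum_cells P Q F f g // ?E = T ` ?B"
  proof (intro set_eqI iffI)
    fix X assume "X \<in> sum_cells P Q F f g // ?E"
    then obtain x where x: "x \<in> sum_cells P Q F f g" "X = ?E `` {x}"
      by (auto simp: quotient_def)
    obtain A where "A \<in> ?B" "x \<in> T A" using x(1) unfolding cells T_def by blast
    then show "X \<in> T ` ?B" using T_class x(2) by blast
  next
    fix X assume "X \<in> T ` ?B"
    then obtain A where A: "A \<in> ?B" "X = T A" by blast
    obtain x where x: "x \<in> T A" using T_nonempty[OF A(1)] by blast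
    then have "x \<in> sum_cells P Q F f g" unfolding cells T_def by blast
    then show "X \<in> sum_cells P Q F f g // ?E"
      unfolding quotient_def using T_class[OF x] A(2) by blast
  qed
  have T_le: "(\<exists>x\<in>T A. \<exists>y\<in>T B. rel_sum (\<subseteq>) (\<subseteq>) x y) \<longleftrightarrow> A \<subseteq> B"
    if AB: "A \<in> ?B" "B \<in> ?B" for A B
  proof
    assume "\<exists>x\<in>T A. \<exists>y\<in>T B. rel_sum (\<subseteq>) (\<subseteq>) x y"
    then consider "A \<in> BP" "B \<in> BP" "\<phi> A \<subseteq> \<phi> B" | "A \<in> BQ" "B \<in> BQ" "\<psi> A \<subseteq> \<psi> B"
      by (auto simp: T_def)
    then show "A \<subseteq> B" by cases (use \<phi>(3) \<psi>(3) in blast)+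
  next
    assume le: "A \<subseteq> B"
    \<comment> \<open>By \<open>mixed\<close>, the smaller of two comparable faces from different
      sides is common to both, so a comparison always takes place within one polytope.\<close>
    consider "A \<in> BP" "B \<in> BP" | "A \<in> BQ" "B \<in> BQ" using AB mixed le by blast
    then show "\<exists>x\<in>T A. \<exists>y\<in>T B. rel_sum (\<subseteq>) (\<subseteq>) x y"
    proof cases
      case 1
      then have "Inl (\<phi> A) \<in> T A" "Inl (\<phi> B) \<in> T B" by (auto simp: T_def)
      moreover have "rel_sum (\<subseteq>) (\<subseteq>) (Inl (\<phi> A)) (Inl (\<phi> B) :: _ + 'd space set)"
        using \<phi>(3)[OF 1] le by simp
      ultimately show ?thesis by blast
    next
      case 2
      then have "Inr (\<psi> A) \<in> T A" "Inr (\<psi> B) \<in> T B" by (auto simp: T_def)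
      moreover have "rel_sum (\<subseteq>) (\<subseteq>) (Inr (\<psi> A) :: 'd space set + _) (Inr (\<psi> B))"
        using \<psi>(3)[OF 2] le by simp
      ultimately show ?thesis by blast
    qed
  qed
  have sum_iff: "(T A, T B) \<in> sum_complex P Q F f g \<longleftrightarrow> A \<subseteq> B" if "A \<in> ?B" "B \<in> ?B" for A B
  proof -
    have "T A \<in> T ` ?B" "T B \<in> T ` ?B" using that by blast+
    then show ?thesis using T_le[OF that] unfolding sum_complex_def quot by simp
  qed
  have Field_sum: "Field (sum_complex P Q F f g) = T ` ?B"
  proof
    show "Field (sum_complex P Q F f g) \<subseteq> T ` ?B"
      unfolding Field_def sum_complex_def quot by blast
    show "T ` ?B \<subseteq> Field (sum_complex P Q F f g)"
    proof
      fix X assume "X \<in> T ` ?B"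
      then obtain A where "A \<in> ?B" "X = T A" by blast
      then show "X \<in> Field (sum_complex P Q F f g)"
        using sum_iff[of A A] by (auto intro: FieldI1)
    qed
  qed
  have Field_faces: "Field (face_lattice R) = insert R ?B"
    by (auto simp: Field_def face_lattice_def faces(1))
  have Field_conn: "Field (connected_sum P Q F f g) = insert None (Some ` T ` ?B)"
    by (simp add: connected_sum_def Field_adjoin_top Field_sum)
  define h where "h = (\<lambda>A. if A = R then None else Some (T A))"
  have hB: "h A = Some (T A)" "A \<noteq> R" if "A \<in> ?B" for A
    using that faces(2) by (auto simp: h_def)
  have hR: "h R = None" by (simp add: h_def)
  have T_eq: "T A = T B \<longleftrightarrow> A = B" if "A \<in> ?B" "B \<in> ?B" for A B
    using T_nonempty[OF that(1)] T_inj by blast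
  show ?thesis
    unfolding order_isomorphic_def
  proof (intro exI[of _ h] conjI ballI)
    show "bij_betw h (Field (face_lattice R)) (Field (connected_sum P Q F f g))"
      unfolding Field_faces Field_conn
    proof (rule bij_betw_imageI)
      show "inj_on h (insert R ?B)"
        by (intro inj_onI) (use hB hR T_eq in \<open>metis insertE option.inject option.distinct(1)\<close>)
      have "h ` ?B = Some ` T ` ?B" using hB(1) by (simp only: image_image cong: image_cong)
      then show "h ` insert R ?B = insert None (Some ` T ` ?B)" by (simp only: image_insert hR)
    qed
    fix A B assume AB: "A \<in> Field (face_lattice R)" "B \<in> Field (face_lattice R)"
    then have lhs: "(A, B) \<in> face_lattice R \<longleftrightarrow> A \<subseteq> B"
      unfolding Field_faces by (simp add: face_lattice_def faces(1))
    have top: "(h A, None) \<in> connected_sum P Q F f g"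
      using AB(1) hB hR unfolding Field_faces connected_sum_def adjoin_top_def Field_sum by force
    consider "B = R" | "A = R" "B \<in> ?B" | "A \<in> ?B" "B \<in> ?B"
      using AB unfolding Field_faces by blast
    then show "(A, B) \<in> face_lattice R \<longleftrightarrow> (h A, h B) \<in> connected_sum P Q F f g"
    proof cases
      case 1
      have "A \<subseteq> R" using AB(1) faces(3) unfolding Field_faces by blast
      then show ?thesis using lhs 1 top hR by simp
    next
      case 2
      have "\<not> R \<subseteq> B" using faces(3)[OF 2(2)] hB(2)[OF 2(2)] by blast
      moreover have "(None, Some (T B)) \<notin> connected_sum P Q F f g"
        by (auto simp: connected_sum_def adjoin_top_def)
      ultimately show ?thesis using lhs 2 hR hB(1) by simp
    next
      case 3
      have "(Some (T A), Some (T B)) \<in> connected_sum P Q F f g \<longleftrightarrow>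
          (T A, T B) \<in> sum_complex P Q F f g"
        by (auto simp: connected_sum_def adjoin_top_def)
      also have "\<dots> \<longleftrightarrow> A \<subseteq> B" by (rule sum_iff[OF 3])
      finally show ?thesis using lhs hB(1) 3 by simp
    qed
  qed
qed

text \<open>The roles of \<open>f\<close> and \<open>g\<close> differ because the first cone is
  carried to \<open>P\<close> by the map inducing \<open>f\<close>, whereas the second has been
  repositioned and the map carrying it to \<open>Q\<close> agrees with \<open>g\<close> on
  \<open>F\<close>.\<close>

lemma face_lattice_glued_cones:
  fixes K1 K2 KF P Q F :: "'d::finite space set"
  assumes glue: "glued_cones K1 K2 KF a" and F: "F = KF \<inter> sphere 0 1"
    and L: "linear L" "bij L" "\<And>x. x \<in> sphere 0 1 \<Longrightarrow> f x = sgn (L x)" "P = L ` K1 \<inter> sphere 0 1"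
    and M: "linear M" "bij M" "\<And>x. x \<in> F \<Longrightarrow> g x = sgn (M x)" "Q = M ` K2 \<inter> sphere 0 1"
  shows "order_isomorphic (face_lattice ((K1 \<union> K2) \<inter> sphere 0 1)) (connected_sum P Q F f g)"
proof -
  interpret glued_cones K1 K2 KF a by (fact glue)
  let ?S = "\<lambda>C. C \<inter> sphere 0 1 :: 'd space set"
  let ?\<phi> = "(`) (\<lambda>x. sgn (L x))" and ?\<psi> = "(`) (\<lambda>x. sgn (M x))"
  define BP where "BP = ?S ` {C. C face_of K1 \<and> C \<noteq> {} \<and> C \<noteq> K1 \<and> C \<noteq> KF}"
  define BQ where "BQ = ?S ` {C. C face_of K2 \<and> C \<noteq> {} \<and> C \<noteq> K2 \<and> C \<noteq> KF}"
  have cone: "convex_cone K1" "convex_cone K2" "convex_cone KF" "convex_cone (K1 \<union> K2)"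
    using P Q F_cone pointed_cone_Un pointed_coneD(2) by blast+
  have face_cone: "convex_cone C" if "C face_of K1 \<or> C face_of K2 \<or> C face_of K1 \<union> K2" "C \<noteq> {}" for C
    using that convex_cone_face[OF P] convex_cone_face[OF Q] convex_cone_face[OF pointed_cone_Un]
    by blast
  have BPE: "\<exists>C. A = ?S C \<and> C face_of K1 \<and> C \<noteq> K1 \<and> C \<noteq> KF \<and> C \<noteq> {} \<and> convex_cone C \<and> C \<subseteq> K1"
    if "A \<in> BP" for A
    using that face_cone face_of_imp_subset[of _ K1] unfolding BP_def by blast
  have BQE: "\<exists>C. A = ?S C \<and> C face_of K2 \<and> C \<noteq> K2 \<and> C \<noteq> KF \<and> C \<noteq> {} \<and> convex_cone C \<and> C \<subseteq> K2"
    if "A \<in> BQ" for A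
    using that face_cone face_of_imp_subset[of _ K2] unfolding BQ_def by blast
  have neq: "K1 \<noteq> KF" "K2 \<noteq> KF" using FP FQ by auto
  have K1_not: "\<not> K1 \<subseteq> K2" and K2_not: "\<not> K2 \<subseteq> K1" using Int_eq neq by blast+
  have BP_eq: "BP = spherical_faces (?S K1) - {?S K1, F}"
    unfolding BP_def spherical_faces_cone[OF P] F
    using sphere_section_eq_iff[OF face_cone cone(1)] sphere_section_eq_iff[OF face_cone cone(3)]
    by blast
  have BQ_eq: "BQ = spherical_faces (?S K2) - {?S K2, F}"
    unfolding BQ_def spherical_faces_cone[OF Q] F
    using sphere_section_eq_iff[OF face_cone cone(2)] sphere_section_eq_iff[OF face_cone cone(3)]
    by blast
  have sub_KF: "C face_of KF" if "C face_of K1 \<or> C face_of K2" "C \<subseteq> KF" for C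
    using that F_sub face_of_subset by blast
  have KF_face: "C face_of K1" "C face_of K2" if "C face_of KF" for C
    using that FP FQ face_of_trans facet_of_imp_face_of by blast+
  have in_both: "?S C \<in> BP \<inter> BQ" if C: "C face_of KF" "C \<noteq> KF" "C \<noteq> {}" for C
  proof -
    have "C \<noteq> K1" "C \<noteq> K2"
      using face_of_imp_subset[OF C(1)] F_sub neq by blast+
    then show ?thesis using KF_face[OF C(1)] C(2,3) unfolding BP_def BQ_def by blast
  qed
  have \<phi>: "bij_betw ?\<phi> (spherical_faces (?S K1)) (spherical_faces P)"
    unfolding L(4) by (rule bij_betw_spherical_faces[OF L(1,2) P])
  have \<psi>: "bij_betw ?\<psi> (spherical_faces (?S K2)) (spherical_faces Q)"
    unfolding M(4) by (rule bij_betw_spherical_faces[OF M(1,2) Q])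
  have section_face: "?S C \<in> spherical_faces (?S K)" if "pointed_cone K" "C face_of K" "C \<noteq> {}" for C K
    using that spherical_faces_cone by blast
  have top_P: "?S K1 \<in> spherical_faces (?S K1)" "F \<in> spherical_faces (?S K1)"
    unfolding F
    by (rule section_face[OF P face_of_refl[OF pointed_coneD(3)[OF P]] pointed_coneD(7)[OF P]],
        rule section_face[OF P facet_of_imp_face_of[OF FP] pointed_coneD(7)[OF F_cone]])
  have top_Q: "?S K2 \<in> spherical_faces (?S K2)" "F \<in> spherical_faces (?S K2)"
    unfolding F
    by (rule section_face[OF Q face_of_refl[OF pointed_coneD(3)[OF Q]] pointed_coneD(7)[OF Q]],
        rule section_face[OF Q facet_of_imp_face_of[OF FQ] pointed_coneD(7)[OF F_cone]])
  have im_P: "?\<phi> (?S K1) = P"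
    unfolding L(4)
    by (rule sgn_linear_image_sphere[OF L(1) bij_is_inj[OF L(2)]])
      (rule convex_cone_scaleR[OF cone(1)], simp_all)
  have im_Q: "?\<psi> (?S K2) = Q"
    unfolding M(4)
    by (rule sgn_linear_image_sphere[OF M(1) bij_is_inj[OF M(2)]])
      (rule convex_cone_scaleR[OF cone(2)], simp_all)
  have FS: "F \<subseteq> sphere 0 1" unfolding F by blast
  have fA: "f ` A = ?\<phi> A" "g ` A = ?\<psi> A" if "A \<subseteq> F" for A
    by (rule image_cong[OF refl]; use that FS L(3) M(3) in blast)+
  show ?thesis
  proof (rule order_isomorphic_connected_sum[where BP = BP and BQ = BQ and \<phi> = ?\<phi> and \<psi> = ?\<psi>])
    show "spherical_faces (?S (K1 \<union> K2)) = insert (?S (K1 \<union> K2)) (BP \<union> BQ)"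
    proof (intro set_eqI iffI)
      fix A assume "A \<in> spherical_faces (?S (K1 \<union> K2))"
      then obtain C where C: "A = ?S C" "C face_of K1 \<union> K2" "C \<noteq> {}"
        unfolding spherical_faces_cone[OF pointed_cone_Un] by blast
      consider "C = K1 \<union> K2" | "C \<subseteq> K1" | "C \<subseteq> K2" using face_Un_cases[OF C(2)] by blast
      then show "A \<in> insert (?S (K1 \<union> K2)) (BP \<union> BQ)"
      proof cases
        case 1 then show ?thesis using C(1) by simp
      next
        case 2
        then have "A \<in> BP" unfolding BP_def C(1) using face_Un_in_P[OF C(2)] C(3) by blast
        then show ?thesis by simp
      next
        case 3
        then have "A \<in> BQ" unfolding BQ_def C(1) using face_Un_in_Q[OF C(2)] C(3) by blast
        then show ?thesis by simp
      qed
    next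
      fix A assume "A \<in> insert (?S (K1 \<union> K2)) (BP \<union> BQ)"
      then obtain C where C: "A = ?S C" "C face_of K1 \<union> K2" "C \<noteq> {}"
        using BPE[of A] BQE[of A] face_P_is_face face_Q_is_face
          face_of_refl[OF convex_Un] pointed_coneD(7)[OF pointed_cone_Un] by (metis UnE insertE)
      then show "A \<in> spherical_faces (?S (K1 \<union> K2))"
        unfolding C(1) by (intro section_face[OF pointed_cone_Un] C(2,3))
    qed
    have proper: "C \<noteq> K1 \<union> K2" if "C \<subseteq> K1 \<or> C \<subseteq> K2" for C
      using that K1_not K2_not by blast
    show "?S (K1 \<union> K2) \<notin> BP \<union> BQ"
    proof
      assume "?S (K1 \<union> K2) \<in> BP \<union> BQ"
      then obtain C where C: "?S (K1 \<union> K2) = ?S C" "C \<subseteq> K1 \<or> C \<subseteq> K2" "convex_cone C"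
        using BPE BQE by (metis UnE)
      then show False using sphere_section_eq_iff[OF cone(4) C(3)] proper[OF C(2)] by simp
    qed
    show "A \<subseteq> ?S (K1 \<union> K2)" if "A \<in> BP \<union> BQ" for A
      using that BPE[of A] BQE[of A] by blast
    show "BP \<inter> BQ = boundary_complex F"
    proof (intro set_eqI iffI)
      fix A assume "A \<in> BP \<inter> BQ"
      then have A: "A \<in> BP" "A \<in> BQ" by simp_all
      obtain C where C: "A = ?S C" "C face_of K1" "C \<noteq> KF" "C \<noteq> {}" "convex_cone C" "C \<subseteq> K1"
        using BPE[OF A(1)] by blast
      obtain D where D: "A = ?S D" "convex_cone D" "D \<subseteq> K2"
        using BQE[OF A(2)] by blast
      have "C = D" using sphere_section_eq_iff[OF C(5) D(2)] C(1) D(1) by simp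
      then have "C \<subseteq> KF" using C(6) D(3) Int_eq by blast
      then have "A \<in> spherical_faces F"
        unfolding F C(1) using sub_KF[of C] C(2,4) section_face[OF F_cone, of C] by simp
      moreover have "A \<noteq> F" unfolding F C(1) using sphere_section_eq_iff[OF C(5) cone(3)] C(3) by simp
      ultimately show "A \<in> boundary_complex F" by (simp add: boundary_complex_def)
    next
      fix A assume "A \<in> boundary_complex F"
      then have "A \<in> spherical_faces (?S KF)" "A \<noteq> ?S KF" by (auto simp: boundary_complex_def F)
      then obtain C where "A = ?S C" "C face_of KF" "C \<noteq> {}" "C \<noteq> KF"
        unfolding spherical_faces_cone[OF F_cone] by blast
      then show "A \<in> BP \<inter> BQ" using in_both by simp
    qed
    \<comment> \<open>A face inside both cones lies in their intersection \<open>KF\<close>, and is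
      therefore a proper face of \<open>KF\<close> shared by both sides.\<close>
    have mixed: "A \<in> BP \<inter> BQ" if A: "A \<in> BP \<union> BQ" "A \<subseteq> ?S K1" "A \<subseteq> ?S K2" for A
    proof -
      obtain C where C: "A = ?S C" "C face_of K1 \<or> C face_of K2" "C \<noteq> KF" "C \<noteq> {}" "convex_cone C"
        using A(1) BPE[of A] BQE[of A] by blast
      have "C \<subseteq> K1" "C \<subseteq> K2"
        using A(2,3) sphere_section_mono_iff[OF C(5) cone(1)] sphere_section_mono_iff[OF C(5) cone(2)]
        unfolding C(1) by blast+
      then have "C \<subseteq> KF" using Int_eq by blast
      then show ?thesis unfolding C(1) using in_both[of C] sub_KF[of C] C(2-4) by simp
    qed
    have sub: "A \<subseteq> ?S K1" if "A \<in> BP" for A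
      using BPE[OF that] by blast
    have subQ: "A \<subseteq> ?S K2" if "A \<in> BQ" for A
      using BQE[OF that] by blast
    show "A \<in> BQ" if "A \<in> BP" "B \<in> BQ" "A \<subseteq> B" for A B
      using mixed[of A] sub[OF that(1)] subQ[OF that(2)] that by blast
    show "B \<in> BP" if "A \<in> BP" "B \<in> BQ" "B \<subseteq> A" for A B
      using mixed[of B] sub[OF that(1)] subQ[OF that(2)] that by blast
    have subset_P: "BP \<subseteq> spherical_faces (?S K1)" and subset_Q: "BQ \<subseteq> spherical_faces (?S K2)"
      unfolding BP_eq BQ_eq by blast+
    show "inj_on ?\<phi> BP" using bij_betw_imp_inj_on[OF \<phi>] subset_P by (rule inj_on_subset)
    show "inj_on ?\<psi> BQ" using bij_betw_imp_inj_on[OF \<psi>] subset_Q by (rule inj_on_subset)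
    have "?\<phi> ` {?S K1, F} = {P, f ` F}"
      by (simp only: image_insert image_empty im_P fA(1)[OF order_refl])
    moreover have "?\<phi> ` BP = ?\<phi> ` spherical_faces (?S K1) - ?\<phi> ` {?S K1, F}"
      unfolding BP_eq
      by (rule inj_on_image_set_diff[OF bij_betw_imp_inj_on[OF \<phi>]]) (use top_P in blast)+
    ultimately have "?\<phi> ` BP = spherical_faces P - {P, f ` F}"
      using bij_betw_imp_surj_on[OF \<phi>] by (simp only:)
    then show "?\<phi> ` BP = boundary_complex P - {f ` F}"
      unfolding boundary_complex_def by (rule trans[OF _ Diff_insert2])
    have "?\<psi> ` {?S K2, F} = {Q, g ` F}"
      by (simp only: image_insert image_empty im_Q fA(2)[OF order_refl])
    moreover have "?\<psi> ` BQ = ?\<psi> ` spherical_faces (?S K2) - ?\<psi> ` {?S K2, F}"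
      unfolding BQ_eq
      by (rule inj_on_image_set_diff[OF bij_betw_imp_inj_on[OF \<psi>]]) (use top_Q in blast)+
    ultimately have "?\<psi> ` BQ = spherical_faces Q - {Q, g ` F}"
      using bij_betw_imp_surj_on[OF \<psi>] by (simp only:)
    then show "?\<psi> ` BQ = boundary_complex Q - {g ` F}"
      unfolding boundary_complex_def by (rule trans[OF _ Diff_insert2])
    have sphere_P: "A \<subseteq> sphere 0 1" if "A \<in> BP" for A
      using sub[OF that] by blast
    have sphere_Q: "A \<subseteq> sphere 0 1" if "A \<in> BQ" for A
      using subQ[OF that] by blast
    show "?\<phi> A \<subseteq> ?\<phi> B \<longleftrightarrow> A \<subseteq> B" if "A \<in> BP" "B \<in> BP" for A B
      by (rule inj_on_image_subset_iff[OF inj_on_sgn_linear[OF L(1) bij_is_inj[OF L(2)]]])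
        (rule sphere_P[OF that(1)], rule sphere_P[OF that(2)])
    show "?\<psi> A \<subseteq> ?\<psi> B \<longleftrightarrow> A \<subseteq> B" if "A \<in> BQ" "B \<in> BQ" for A B
      by (rule inj_on_image_subset_iff[OF inj_on_sgn_linear[OF M(1) bij_is_inj[OF M(2)]]])
        (rule sphere_Q[OF that(1)], rule sphere_Q[OF that(2)])
    show "f ` A = ?\<phi> A \<and> g ` A = ?\<psi> A" if "A \<in> boundary_complex F" for A
    proof -
      have "A \<in> ?S ` {C. C face_of KF \<and> C \<noteq> {}}"
        using that unfolding boundary_complex_def F spherical_faces_cone[OF F_cone] by (rule DiffD1)
      then obtain C where "A = ?S C" "C face_of KF" by blast
      then have "A \<subseteq> F" unfolding F using face_of_imp_subset[of C KF] by blast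
      then show ?thesis by (intro conjI fA)
    qed
  qed
qed

lemma ridge_scribed_cone_glued:
  fixes K1 K2 KF :: "'d::finite space set"
  assumes glue: "glued_cones K1 K2 KF a" and K1: "ridge_scribed_cone K1" and K2: "ridge_scribed_cone K2"
  shows "ridge_scribed_cone (K1 \<union> K2)"
proof -
  interpret glued_cones K1 K2 KF a by (fact glue)
  have "aff_dim K1 \<le> aff_dim (K1 \<union> K2)" by (rule aff_dim_subset) simp
  moreover have "aff_dim (K1 \<union> K2) \<le> int DIM('d space)" by (rule aff_dim_le_DIM)
  ultimately have dim: "aff_dim (K1 \<union> K2) = int CARD('d) + 1"
    using ridge_scribed_coneD(2)[OF K1] by simp
  have "tangent_face (C \<inter> sphere 0 1)" if C: "C face_of K1 \<union> K2" "aff_dim C = int CARD('d) - 1" for C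
  proof -
    have "C \<noteq> K1 \<union> K2" using C(2) dim by auto
    then have "C face_of K1 \<or> C face_of K2"
      using face_Un_cases[OF C(1)] face_Un_in_P(1)[OF C(1)] face_Un_in_Q(1)[OF C(1)] by blast
    then show ?thesis
      using ridge_scribed_coneD(3)[OF K1 _ C(2)] ridge_scribed_coneD(3)[OF K2 _ C(2)] by blast
  qed
  then show ?thesis
    unfolding ridge_scribed_cone_def by (intro conjI allI impI pointed_cone_Un dim)
qed

text \<open>Reflecting in the hyperplane of the common facet moves the second cone to the other side.\<close>

lemma opposite_side:
  fixes K1 K2 F :: "'d::finite space set"
  assumes K1: "ridge_scribed_cone K1" and F1: "F facet_of K1"
    and K2: "ridge_scribed_cone K2" and F2: "F facet_of K2"
  obtains \<rho> a where "lorentz_map \<rho>" "\<And>x. x \<in> F \<Longrightarrow> \<rho> x = x" "glued_cones K1 (\<rho> ` K2) F a"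
proof -
  note P1 = ridge_scribed_coneD(1)[OF K1] and P2 = ridge_scribed_coneD(1)[OF K2]
  note Fc = facet_cone[OF K1 F1]
  obtain a where a: "a \<noteq> 0" "\<And>x. x \<in> K1 \<Longrightarrow> 0 \<le> a \<bullet> x" "F = K1 \<inter> {x. a \<bullet> x = 0}"
    using pointed_cone_facetE[OF P1 F1] by blast
  obtain b where b: "b \<noteq> 0" "\<And>x. x \<in> K2 \<Longrightarrow> 0 \<le> b \<bullet> x" "F = K2 \<inter> {x. b \<bullet> x = 0}"
    using pointed_cone_facetE[OF P2 F2] by blast
  have "int (dim F) = int CARD('d)" using aff_dim_eq_dim_pointed[OF Fc(1)] Fc(2) by simp
  then have dimF: "dim F + 1 = DIM('d space)" unfolding DIM_space by linarith
  have aF: "a \<bullet> x = 0" and bF: "b \<bullet> x = 0" if "x \<in> F" for x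
    using that a(3) b(3) by blast+
  \<comment> \<open>Both functionals are normal to the hyperplane of \<open>F\<close>. The sign of
    \<open>c\<close> tells whether the second cone is already on the opposite side, in which case
    the identity serves as \<open>\<rho>\<close>.\<close>
  obtain c where c: "a = c *\<^sub>R b"
    using span_single_of_codim1[OF dimF bF aF b(1)] by blast
  have "c \<noteq> 0" using a(1) c by auto
  then have F2a: "F = K2 \<inter> {x. a \<bullet> x = 0}" using b(3) c by simp
  have ex: "\<exists>\<rho>. lorentz_map \<rho> \<and> (\<forall>x\<in>F. \<rho> x = x) \<and> (\<forall>x\<in>K2. a \<bullet> \<rho> x \<le> 0 \<and> (a \<bullet> \<rho> x = 0 \<longleftrightarrow> a \<bullet> x = 0))"
  proof (cases "c < 0")
    case True
    have "a \<bullet> x \<le> 0" if "x \<in> K2" for x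
      using b(2)[OF that] True c by (simp add: mult_nonpos_nonneg)
    moreover have "lorentz_map (\<lambda>x :: 'd space. x)"
      by (simp add: lorentz_map_def linear_iff bij_betw_def)
    ultimately show ?thesis by (intro exI[of _ "\<lambda>x. x"]) auto
  next
    case False
    obtain z where z: "z \<in> F" "norm (snd z) < fst z"
      using ridge_scribed_facet_timelike[OF K1 F1] by blast
    note az = a(1) aF[OF z(1)]
    have "mirror a \<bullet> a \<noteq> 0" using orthogonal_timelike_spacelike[OF z(2) az] by simp
    then have refl: "a \<bullet> reflection a x = - (a \<bullet> x)" for x by (rule reflection_inner)
    have nn: "0 \<le> a \<bullet> x" if "x \<in> K2" for x
      using b(2)[OF that] False c by simp
    have "reflection a x = x" if "x \<in> F" for x
      using aF[OF that] by (simp add: reflection_def)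
    then show ?thesis
      using reflection_lorentz_map[OF z(2) az] refl nn by (intro exI[of _ "reflection a"]) simp
  qed
  then obtain \<rho> where \<rho>: "lorentz_map \<rho>" "\<And>x. x \<in> F \<Longrightarrow> \<rho> x = x"
    "\<And>x. x \<in> K2 \<Longrightarrow> a \<bullet> \<rho> x \<le> 0" "\<And>x. x \<in> K2 \<Longrightarrow> a \<bullet> \<rho> x = 0 \<longleftrightarrow> a \<bullet> x = 0"
    by blast
  note \<rho>' = lorentz_mapD[OF \<rho>(1)]
  have \<rho>F: "\<rho> ` F = F" using \<rho>(2) by force
  have "\<rho> ` F facet_of \<rho> ` K2"
    using F2 \<rho>'(1,3) by (simp add: facet_of_def face_of_linear_image)
  moreover have "F = \<rho> ` K2 \<inter> {x. a \<bullet> x = 0}"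
  proof -
    have "\<rho> ` F = \<rho> ` K2 \<inter> {x. a \<bullet> x = 0}"
      using F2a \<rho>(4) by blast
    then show ?thesis using \<rho>F by simp
  qed
  ultimately have glued: "glued_cones K1 (\<rho> ` K2) F a"
    using \<rho>(3) \<rho>F
    by (intro glued_ridge_scribed_cones[OF K1 ridge_scribed_cone_lorentz_map[OF \<rho>(1) K2] F1 _ a]) auto
  show ?thesis by (rule that[OF \<rho>(1) _ glued]) (rule \<rho>(2))
qed

text \<open>A convex cone is determined by its section, so the cone face behind the image of
  \<open>F\<close> under \<open>f\<close> is the \<open>L\<close>-image of the cone over
  \<open>F\<close>; the inverse of \<open>L\<close> brings it back.\<close>

lemma facet_pullback:
  fixes P F :: "'d::finite space set"
  assumes P: "ridge_scribed P" and F: "spherical_polytope F" and L: "lorentz_map L"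
    and f: "\<And>x. x \<in> sphere 0 1 \<Longrightarrow> f x = sgn (L x)" and fF: "f ` F \<in> facets P"
  shows "ridge_scribed_cone (inv L ` (convex_cone hull P))"
    "convex_cone hull F facet_of inv L ` (convex_cone hull P)"
    "P = L ` inv L ` (convex_cone hull P) \<inter> sphere 0 1"
proof -
  let ?K = "convex_cone hull P" and ?F = "convex_cone hull F"
  note L' = lorentz_mapD[OF L] and I = lorentz_map_inv[OF L]
  have "spherical_polytope P" using P by (simp add: ridge_scribed_def d_polytope_def)
  note PK = spherical_polytope_cone[OF this] and FK = spherical_polytope_cone[OF F]
  have K: "ridge_scribed_cone ?K"
    using ridge_scribed_iff_cone[OF PK(1)] PK(2) P by simp
  then show "ridge_scribed_cone (inv L ` ?K)" by (rule ridge_scribed_cone_lorentz_map[OF I])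
  show "P = L ` inv L ` ?K \<inter> sphere 0 1" using PK(2) inv_image_cancel(2)[OF L] by simp
  obtain C where C: "f ` F = C \<inter> sphere 0 1" "C face_of ?K" "aff_dim C = int CARD('d)"
    using fF by (auto simp: facets_def spherical_k_faces_def)
  have "C \<noteq> {}" using C(3) by auto
  have "f ` F = (\<lambda>x. sgn (L x)) ` F" using f FK(2) by (intro image_cong refl) blast
  also have "\<dots> = (\<lambda>x. sgn (L x)) ` (?F \<inter> sphere 0 1)" using FK(2) by simp
  also have "\<dots> = L ` ?F \<inter> sphere 0 1"
    by (rule sgn_linear_image_sphere[OF L'(1,3)]) (simp add: convex_cone_hull_mul)
  finally have "C \<inter> sphere 0 1 = L ` ?F \<inter> sphere 0 1" using C(1) by simp
  moreover have "convex_cone (L ` ?F)"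
    using convex_cone_linear_image[of ?F L] convex_cone_convex_cone_hull[of F] L'(1) by simp
  ultimately have "C = L ` ?F"
    using sphere_section_eq_iff[OF convex_cone_face[OF PK(1) C(2) \<open>C \<noteq> {}\<close>], of "L ` ?F"] by simp
  then have "inv L ` C = ?F" using inv_image_cancel(1)[OF L] by simp
  moreover have "inv L ` C facet_of inv L ` ?K"
    using C(2,3) \<open>C \<noteq> {}\<close> ridge_scribed_coneD(2)[OF K] lorentz_mapD(1,3)[OF I]
    by (simp add: facet_of_def face_of_linear_image)
  ultimately show "?F facet_of inv L ` ?K" by simp
qed

theorem proposition5p7:
  fixes P Q F :: "'d::finite space set"
    and f g :: "'d space \<Rightarrow> 'd space"
  assumes "ridge_scribed P" and "ridge_scribed Q"
    and "spherical_polytope F" and "spherical_dim F = int CARD('d) - 1"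
    and "moebius_map f" and "f ` F \<in> facets P"
    and "moebius_map g" and "g ` F \<in> facets Q"
  shows "ridge_scribable TYPE('d) (connected_sum P Q F f g)"
proof -
  obtain L where L: "lorentz_map L" "\<And>x. x \<in> sphere 0 1 \<Longrightarrow> f x = sgn (L x)"
    using assms(5) by (auto simp: moebius_map_def lorentz_map_def)
  obtain M where M: "lorentz_map M" "\<And>x. x \<in> sphere 0 1 \<Longrightarrow> g x = sgn (M x)"
    using assms(7) by (auto simp: moebius_map_def lorentz_map_def)
  let ?F = "convex_cone hull F"
  define K1 where "K1 = inv L ` (convex_cone hull P)"
  define K2 where "K2 = inv M ` (convex_cone hull Q)"
  note K1 = facet_pullback[OF assms(1,3) L assms(6), folded K1_def]
  note K2 = facet_pullback[OF assms(2,3) M assms(8), folded K2_def]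
  obtain \<rho> a where \<rho>: "lorentz_map \<rho>" "\<And>x. x \<in> ?F \<Longrightarrow> \<rho> x = x"
    and glue: "glued_cones K1 (\<rho> ` K2) ?F a"
    using opposite_side[OF K1(1,2) K2(1,2)] by blast
  let ?R = "(K1 \<union> \<rho> ` K2) \<inter> sphere 0 1"
  \<comment> \<open>The map from the reflected cone back to \<open>Q\<close>. As
    \<open>\<rho>\<close> fixes the cone over \<open>F\<close> pointwise, it still induces
    \<open>g\<close> on \<open>F\<close>.\<close>
  define N where "N = M \<circ> inv \<rho>"
  have N: "lorentz_map N"
    unfolding N_def by (intro lorentz_map_comp lorentz_map_inv M(1) \<rho>(1))
  have F: "F = ?F \<inter> sphere 0 1" by (rule spherical_polytope_cone(2)[OF assms(3)])
  have NF: "g x = sgn (N x)" if "x \<in> F" for x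
  proof -
    have x: "x \<in> ?F" "x \<in> sphere 0 1" using that F by blast+
    have "inv \<rho> x = x" using \<rho>(2)[OF x(1)] inv_f_f[OF lorentz_mapD(3)[OF \<rho>(1)], of x] by simp
    then show ?thesis using M(2)[OF x(2)] by (simp add: N_def)
  qed
  have "N ` \<rho> ` K2 = M ` K2"
    unfolding N_def image_comp[symmetric] inv_image_cancel(1)[OF \<rho>(1)] ..
  then have NQ: "Q = N ` \<rho> ` K2 \<inter> sphere 0 1" using K2(3) by simp
  have "order_isomorphic (face_lattice ?R) (connected_sum P Q F f g)"
    by (rule face_lattice_glued_cones[OF glue F lorentz_mapD(1,2)[OF L(1)] L(2) K1(3)
          lorentz_mapD(1,2)[OF N] NF NQ])
  moreover have "ridge_scribed_cone (K1 \<union> \<rho> ` K2)"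
    using ridge_scribed_cone_glued[OF glue K1(1)] ridge_scribed_cone_lorentz_map[OF \<rho>(1) K2(1)] by blast
  then have "ridge_scribed ?R"
    using ridge_scribed_iff_cone[OF ridge_scribed_coneD(1)] by blast
  ultimately show ?thesis
    unfolding ridge_scribable_def realization_def ridge_scribed_def by blast
qed

end
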